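(* Assume (i)–(iv) of the standing assumption on $\mathbf{g}$ given in the context, and assume that, for some $D>0$, $\|\mathbf{x}_*\|\le \frac{D}{2}$ and $\|\bar{\mathbf{z}}_k\|\le \frac{D}{2}$ for all $k$, where $\bar{\mathbf{z}}_k=\frac1M\sum_{i=1}^M\mathbf{z}_k^i$. Let $m$ be the size of the minibatch used in each machine to estimate the stochastic gradient, and let $\rho=\max(|\lambda_2(W)|,|\lambda_M(W)|)<1$. Run the algorithm DPOSG described in the context for $N$ iterations, with $$t\ge \log_{\frac1\rho}\left(1+\frac{M\sqrt{mMG^2+\sigma^2}}{4\sigma}\right),\qquad \eta\le \min\left(\frac{1}{6\sqrt2 L},\ \frac{1-\rho^t}{\sqrt{32cM}\,L},\ \frac{\sqrt{1-\rho^{2t}}}{4m^{1/4}M^{3/4}L}\right),\qquad c=321 .$$ Then $$\frac1N\sum_{k=0}^{N-1}\mathbb{E}\left\|\mathbf{g}(\bar{\mathbf{z}}_k)\right\|^2\le 8\left(\frac{\|\mathbf{x}_0-\mathbf{x}_*\|^2}{\eta^2N}+\frac{20\sigma^2}{mM}+\frac{48(DL\sigma+\sigma^2)}{\sqrt{mM}}\right).$$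
   Context: Problem: $\min_{\mathbf{u}}\max_{\mathbf{v}}F(\mathbf{u},\mathbf{v}):=\mathbb{E}_{\xi\sim\mathcal{D}}[f(\mathbf{u},\mathbf{v};\xi)]$, with $F$ possibly nonconvex in $\mathbf{u}$ and nonconcave in $\mathbf{v}$. Write $\mathbf{x}=(\mathbf{u},\mathbf{v})\in\mathbb{R}^d$, $\mathbf{g}(\mathbf{x})=[\nabla_{\mathbf{u}}F(\mathbf{u},\mathbf{v}),-\nabla_{\mathbf{v}}F(\mathbf{u},\mathbf{v})]^\top$ and $\mathbf{g}(\mathbf{x};\xi)=[\nabla_{\mathbf{u}}f(\mathbf{u},\mathbf{v};\xi),-\nabla_{\mathbf{v}}f(\mathbf{u},\mathbf{v};\xi)]^\top$. $\|\cdot\|$ is the Euclidean norm for vectors. Standing assumption: (i) $\|\mathbf{g}(\mathbf{x}_1)-\mathbf{g}(\mathbf{x}_2)\|\le L\|\mathbf{x}_1-\mathbf{x}_2\|$ for all $\mathbf{x}_1,\mathbf{x}_2$; (ii) for all $\mathbf{x}$, $\mathbb{E}[\mathbf{g}(\mathbf{x};\xi)]=\mathbf{g}(\mathbf{x})$ and $\mathbb{E}\|\mathbf{g}(\mathbf{x};\xi)-\mathbf{g}(\mathbf{x})\|^2\le\sigma^2$; (iii) $\|\mathbf{g}(\mathbf{x})\|\le G$ for all $\mathbf{x}$; (iv) there exists $\mathbf{x}_*$ such that $\langle\mathbf{g}(\mathbf{x}),\mathbf{x}-\mathbf{x}_*\rangle\ge0$ for all $\mathbf{x}$. Network: there are $M$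 machines and a doubly stochastic matrix $W\in\mathbb{R}^{M\times M}$ with $0\le W_{ij}\le1$, $W^\top=W$, $\sum_{j=1}^MW_{ij}=1$. $\lambda_i(W)$ is the $i$-th largest eigenvalue (so $\lambda_1(W)=1$), and it is assumed that $\rho=\max(|\lambda_2(W)|,|\lambda_M(W)|)<1$. Algorithm DPOSG (step size $\eta>0$, number of averaging rounds $t$): $\mathbf{z}_k^i,\mathbf{x}_k^i\in\mathbb{R}^d$ are the variables of machine $i$ at iteration $k$; $Z_k=[\mathbf{z}_k^1,\dots,\mathbf{z}_k^M]$, $X_k=[\mathbf{x}_k^1,\dots,\mathbf{x}_k^M]\in\mathbb{R}^{d\times M}$. Start from $Z_0=X_0=\mathbf{0}_{d\times M}$ (so the common initial point is $\mathbf{x}_0=\mathbf{0}$). For $k=1,\dots,N$: $$Z_k=X_{k-1}W^t-\eta\,\widehat{\mathbf{g}}(\xi_{k-1},Z_{k-1}),\qquad X_k=X_{k-1}W^t-\eta\,\widehat{\mathbf{g}}(\xi_k,Z_k),$$ where $\widehat{\mathbf{g}}(\xi_k,Z_k)=[\mathbf{g}(\mathbf{z}_k^1;\xi_k^1),\dots,\mathbf{g}(\mathbf{z}_k^M;\xi_k^M)]$. Here $\xi_k^i=(\xi_k^{i,1},\dots,\xi_k^{i,m})$ is a minibatch of $m$ samples from $\mathcal{D}$, $\mathbf{g}(\mathbf{z};\xi_k^i)=\frac1m\sum_{j=1}^m\mathbf{g}(\mathbf{z};\xi_k^{i,j})$, and all samples are independent across $i,j,k$. *)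

theory Defs
  imports "HOL-Probability.Probability" "Jordan_Normal_Form.Char_Poly"
begin

definition gradient :: "('a::euclidean_space \<Rightarrow> real) \<Rightarrow> 'a \<Rightarrow> 'a" where
  "gradient h x = (THE d. gderiv h x d)"

text \<open>The min-max operator of a function of two blocks: the partial gradient in the
  minimization variable, and minus the partial gradient in the maximization variable.\<close>

definition saddle_grad ::
  "('a::euclidean_space \<Rightarrow> 'b::euclidean_space \<Rightarrow> real) \<Rightarrow> 'a \<times> 'b \<Rightarrow> 'a \<times> 'b" where
  "saddle_grad h x =
     (gradient (\<lambda>u. h u (snd x)) (fst x), - gradient (\<lambda>v. h (fst x) v) (snd x))"

definition partially_differentiable ::
  "('a::euclidean_space \<Rightarrow> 'b::euclidean_space \<Rightarrow> real) \<Rightarrow> bool" where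
  "partially_differentiable h \<longleftrightarrow>
     (\<forall>u v. (\<lambda>u'. h u' v) differentiable (at u) \<and> (\<lambda>v'. h u v') differentiable (at v))"

definition expected_obj ::
  "'s measure \<Rightarrow> ('a \<Rightarrow> 'b \<Rightarrow> 's \<Rightarrow> real) \<Rightarrow> 'a \<Rightarrow> 'b \<Rightarrow> real" where
  "expected_obj \<D> f u v = (\<integral>s. f u v s \<partial>\<D>)"

text \<open>The \<open>i\<close>-th largest eigenvalue, counted with multiplicity, with \<open>i\<close> starting at 1.
  It is meant for real symmetric matrices, whose characteristic polynomial splits over the
  reals, so that the list below has as many entries as the matrix has rows.\<close>

definition eigval :: "real mat \<Rightarrow> nat \<Rightarrow> real" where
  "eigval W i = rev (sorted_list_of_multiset (proots (char_poly W))) ! (i - 1)"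

definition mixing_rate :: "real mat \<Rightarrow> real" where
  "mixing_rate W = max \<bar>eigval W 2\<bar> \<bar>eigval W (dim_row W)\<bar>"

definition sym_doubly_stochastic :: "nat \<Rightarrow> real mat \<Rightarrow> bool" where
  "sym_doubly_stochastic M W \<longleftrightarrow>
     W \<in> carrier_mat M M \<and> transpose_mat W = W \<and>
     (\<forall>i<M. \<forall>j<M. 0 \<le> W $$ (i, j) \<and> W $$ (i, j) \<le> 1) \<and>
     (\<forall>i<M. (\<Sum>j<M. W $$ (i, j)) = 1)"

text \<open>A matrix with \<open>M\<close> columns from a vector space is represented by the function that maps
  \<open>i < M\<close> to its column \<open>i\<close>; \<open>mix M A X i\<close> is column \<open>i\<close> of the product \<open>X A\<close>.\<close>

definition mix :: "nat \<Rightarrow> real mat \<Rightarrow> (nat \<Rightarrow> 'c::real_vector) \<Rightarrow> nat \<Rightarrow> 'c" where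
  "mix M A X i = (\<Sum>j<M. A $$ (j, i) *\<^sub>R X j)"

definition column_avg :: "nat \<Rightarrow> (nat \<Rightarrow> 'c::real_vector) \<Rightarrow> 'c" where
  "column_avg M X = (1 / real M) *\<^sub>R (\<Sum>i<M. X i)"

definition minibatch_grad ::
  "('c \<Rightarrow> 's \<Rightarrow> 'c::real_vector) \<Rightarrow> nat \<Rightarrow> 'c \<Rightarrow> (nat \<Rightarrow> 's) \<Rightarrow> 'c" where
  "minibatch_grad gs m z s = (1 / real m) *\<^sub>R (\<Sum>j<m. gs z (s j))"

text \<open>The iterates of DPOSG along one realization \<open>s\<close> of the samples, where \<open>s k i j\<close> is the
  \<open>j\<close>-th sample of machine \<open>i\<close> at iteration \<open>k\<close>, \<open>gs\<close> is the stochastic gradient, \<open>m\<close> the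
  minibatch size, \<open>\<eta>\<close> the step size and \<open>t\<close> the number of averaging rounds.\<close>

fun dposg_Z dposg_X ::
  "('c \<Rightarrow> 's \<Rightarrow> 'c::real_vector) \<Rightarrow> nat \<Rightarrow> real mat \<Rightarrow> nat \<Rightarrow> nat \<Rightarrow> real \<Rightarrow>
   (nat \<Rightarrow> nat \<Rightarrow> nat \<Rightarrow> 's) \<Rightarrow> nat \<Rightarrow> nat \<Rightarrow> 'c" where
  "dposg_Z gs M W t m \<eta> s 0 i = 0"
| "dposg_Z gs M W t m \<eta> s (Suc k) i =
     mix M (W ^\<^sub>m t) (dposg_X gs M W t m \<eta> s k) i
     - \<eta> *\<^sub>R minibatch_grad gs m (dposg_Z gs M W t m \<eta> s k i) (s k i)"
| "dposg_X gs M W t m \<eta> s 0 i = 0"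
| "dposg_X gs M W t m \<eta> s (Suc k) i =
     mix M (W ^\<^sub>m t) (dposg_X gs M W t m \<eta> s k) i
     - \<eta> *\<^sub>R minibatch_grad gs m (dposg_Z gs M W t m \<eta> s (Suc k) i) (s (Suc k) i)"

end

theory Submission
  imports Defs
begin

text \<open>Write \<open>z_i\<close> for the columns of an iterate, \<open>z\<close> for their average, \<open>u\<close> for the averaged
  stochastic gradient and \<open>r = \<rho>\<^sup>t\<close>. The averaged iterates perform an optimistic gradient step, whose
  energy identity bounds the sum of \<open>|u_k|\<^sup>2\<close> by \<open>|x_0 - x_*|\<^sup>2 / \<eta>\<^sup>2\<close>, the drift
  \<open>|u_(k+1) - u_k|\<^sup>2\<close>, and the terms \<open>- \<langle>u_k, z - x_*\<rangle>\<close>. The noise in \<open>u_k\<close> has conditional mean zero and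
  variance at most \<open>\<sigma>\<^sup>2 / (m M)\<close>, and applying the Minty condition at each \<open>z_i\<close> separately gives
  \<open>\<langle>(1/M) \<Sum> g(z_i), z - x_*\<rangle> \<ge> - L (1/M) \<Sum> |z_i - z|\<^sup>2\<close>, so only the mean square consensus error enters.
  That error is of order \<open>\<eta>\<^sup>2 \<sigma>\<^sup>2 / m\<close>: on vectors orthogonal to the constants, \<open>W\<^sup>t\<close> contracts by
  \<open>r\<close>, and the lower bound on \<open>t\<close> forces \<open>r \<le> 2/3\<close>. Finally \<open>\<eta> L \<le> 1 / (100 \<surd>M)\<close> turns the error
  \<open>2 L \<eta> \<sigma>\<^sup>2 / m\<close> into a term of order \<open>\<sigma>\<^sup>2 / \<surd>(m M)\<close>.\<close>

text \<open>The rate \<open>\<rho>\<close> is read off a sorted list of roots of the characteristic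
  polynomial, whereas the analysis needs an operator bound on vectors of sum zero. Two facts connect
  them. The list is complete because symmetric matrices have only real roots. And if
  \<open>\<rho> < 1\<close>, then 1 occurs only once in it, so an eigenvector orthogonal to the
  constants cannot belong to 1. On that subspace the operator norm is the absolute value of an
  eigenvalue, by a variational argument, so one extremal eigenvector replaces a diagonalisation. The
  threshold 2/3 matters because separating mixing from gradient noise doubles squares: the squared
  consensus error contracts by 2 (2/3)^2 = 8/9 < 1. The step-size constant 10272 = 32 * 321 then
  leaves room for the feedback of this error through the Lipschitz gradients. Instead of conditional
  expectations, the law of (past, new sample) is shown to be a product and Fubini's theorem does the
  conditioning. This requires the stochastic gradient to be jointly measurable in point and
  sample.\<close>

unbundle no vec_syntax

subsection \<open>Characteristic polynomials of symmetric matrices\<close>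

text \<open>Induction peels off one root: the fundamental theorem of algebra supplies a complex
  root, the hypothesis makes it real, and the cofactor inherits the hypothesis because its complex
  roots are among those of \<open>p\<close>.\<close>

lemma size_proots_eq_degree_if_real_roots:
  fixes p :: "real poly"
  assumes "p \<noteq> 0" and "\<And>z::complex. poly (map_poly of_real p) z = 0 \<Longrightarrow> z \<in> \<real>"
  shows "size (proots p) = degree p"
  using assms
proof (induction "degree p" arbitrary: p)
  case 0
  then obtain a where "p = [:a:]" by (metis degree_eq_zeroE)
  then show ?case by simp
next
  case (Suc n)
  have "degree (map_poly complex_of_real p) = Suc n"
    using Suc.hyps by simp
  then have "\<not> constant (poly (map_poly complex_of_real p))"
    by (simp add: constant_degree)
  then obtain z where z: "poly (map_poly complex_of_real p) z = 0"
    using fundamental_theorem_of_algebra by blast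
  then obtain a where a: "z = of_real a" using Suc.prems(2) by (metis Reals_cases)
  with z have "poly p a = 0" by simp
  then obtain q where q: "p = [:-a, 1:] * q" by (metis dvdE poly_eq_0_iff_dvd)
  with Suc.prems have q0: "q \<noteq> 0" by auto
  have n: "degree p = Suc (degree q)" unfolding q using q0 by (subst degree_mult_eq) auto
  have "size (proots q) = degree q"
  proof (rule Suc.hyps(1))
    show "n = degree q" using n Suc.hyps(2) by simp
    show "q \<noteq> 0" by fact
    interpret h: map_poly_comm_ring_hom "of_real :: real \<Rightarrow> complex" ..
    fix z :: complex assume "poly (map_poly of_real q) z = 0"
    then have "poly (map_poly of_real p) z = 0"
      unfolding q h.hom_mult by simp
    then show "z \<in> \<real>" using Suc.prems(2) by blast
  qed
  moreover have "proots p = add_mset a (proots q)"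
    unfolding q using q0 by (subst proots_mult) auto
  ultimately show ?case using n by simp
qed

definition symmetric_on :: "nat \<Rightarrow> real mat \<Rightarrow> bool" where
  "symmetric_on M W \<longleftrightarrow> W \<in> carrier_mat M M \<and> (\<forall>i<M. \<forall>j<M. W $$ (i, j) = W $$ (j, i))"

text \<open>Vectors are plain functions of which only the values below \<open>M\<close> count. This
  gives access to the product topology for the compactness argument and lets the coordinates of
  Euclidean columns serve as vectors.\<close>

definition matvec :: "nat \<Rightarrow> real mat \<Rightarrow> (nat \<Rightarrow> real) \<Rightarrow> nat \<Rightarrow> real" where
  "matvec M W y i = (\<Sum>j<M. W $$ (i, j) * y j)"

lemma matvec_adjoint:
  assumes "symmetric_on M W"
  shows "(\<Sum>i<M. matvec M W a i * b i) = (\<Sum>i<M. a i * matvec M W b i)"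
proof -
  have "(\<Sum>i<M. matvec M W a i * b i) = (\<Sum>i<M. \<Sum>j<M. W $$ (i, j) * a j * b i)"
    by (simp add: matvec_def sum_distrib_right)
  also have "\<dots> = (\<Sum>j<M. \<Sum>i<M. W $$ (i, j) * a j * b i)" by (rule sum.swap)
  also have "\<dots> = (\<Sum>j<M. \<Sum>i<M. a j * (W $$ (j, i) * b i))"
    using assms by (intro sum.cong refl) (auto simp: symmetric_on_def)
  finally show ?thesis by (simp add: matvec_def sum_distrib_left)
qed

lemma mult_mat_vec_eq_sum:
  fixes W :: "'a::semiring_0 mat"
  assumes "W \<in> carrier_mat M M" and "v \<in> carrier_vec M" and "i < M"
  shows "(W *\<^sub>v v) $ i = (\<Sum>j<M. W $$ (i, j) * v $ j)"
  using assms by (auto simp: scalar_prod_def atLeast0LessThan)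

lemma eigenvalue_iff_matvec:
  assumes "W \<in> carrier_mat M M"
  shows "poly (char_poly W) l = 0 \<longleftrightarrow>
    (\<exists>y. (\<exists>i<M. y i \<noteq> 0) \<and> (\<forall>i<M. matvec M W y i = l * y i))"
proof -
  have "poly (char_poly W) l = 0 \<longleftrightarrow> eigenvalue W l"
    using eigenvalue_root_char_poly[OF assms] by simp
  also have "\<dots> \<longleftrightarrow> (\<exists>y. (\<exists>i<M. y i \<noteq> 0) \<and> (\<forall>i<M. matvec M W y i = l * y i))"
  proof
    assume "eigenvalue W l"
    then obtain v where v: "v \<in> carrier_vec M" "v \<noteq> 0\<^sub>v M" "W *\<^sub>v v = l \<cdot>\<^sub>v v"
      using assms unfolding eigenvalue_def eigenvector_def by auto
    have "matvec M W (\<lambda>i. v $ i) i = l * v $ i" if "i < M" for i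
    proof -
      have "(W *\<^sub>v v) $ i = l * v $ i" using v that by simp
      then show ?thesis unfolding mult_mat_vec_eq_sum[OF assms v(1) that] matvec_def .
    qed
    moreover have "\<exists>i<M. v $ i \<noteq> 0" using v by (auto simp: vec_eq_iff)
    ultimately show "\<exists>y. (\<exists>i<M. y i \<noteq> 0) \<and> (\<forall>i<M. matvec M W y i = l * y i)" by blast
  next
    assume "\<exists>y. (\<exists>i<M. y i \<noteq> 0) \<and> (\<forall>i<M. matvec M W y i = l * y i)"
    then obtain y where y: "\<exists>i<M. y i \<noteq> 0" "\<forall>i<M. matvec M W y i = l * y i" by blast
    have "eigenvector W (vec M y) l"
      unfolding eigenvector_def using assms y
      by (auto simp: vec_eq_iff matvec_def scalar_prod_def atLeast0LessThan)
    then show "eigenvalue W l" unfolding eigenvalue_def by blast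
  qed
  finally show ?thesis .
qed

text \<open>Let \<open>a\<close> and \<open>b\<close> be the real and imaginary parts of an
  eigenvector. Then Wa = Re l a - Im l b and Wb = Im l a + Re l b; symmetry equates <Wa, b> with <a,
  Wb>, and what remains is Im l (|a|^2 + |b|^2) = 0.\<close>

lemma complex_eigenvalue_symmetric_real:
  assumes "symmetric_on M W" and "poly (map_poly of_real (char_poly W)) (l::complex) = 0"
  shows "l \<in> \<real>"
proof -
  have W: "W \<in> carrier_mat M M" using assms(1) by (simp add: symmetric_on_def)
  define C where "C = map_mat complex_of_real W"
  have C: "C \<in> carrier_mat M M" using W by (simp add: C_def)
  have "poly (char_poly C) l = 0"
    using assms(2) of_real_hom.char_poly_hom[OF W, where 'a=complex] by (simp add: C_def)
  then obtain v where v: "v \<in> carrier_vec M" "v \<noteq> 0\<^sub>v M" "C *\<^sub>v v = l \<cdot>\<^sub>v v"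
    using eigenvalue_root_char_poly[OF C] C unfolding eigenvalue_def eigenvector_def by auto
  define a b where "a = (\<lambda>i. Re (v $ i))" and "b = (\<lambda>i. Im (v $ i))"
  have e: "(\<Sum>j<M. of_real (W $$ (i, j)) * v $ j) = l * v $ i" if "i < M" for i
  proof -
    have "(C *\<^sub>v v) $ i = l * v $ i" using v that by simp
    then show ?thesis unfolding mult_mat_vec_eq_sum[OF C v(1) that] using W that by (simp add: C_def)
  qed
  have ea: "matvec M W a i = Re l * a i - Im l * b i" if "i < M" for i
    using arg_cong[OF e[OF that], of Re] by (simp add: matvec_def a_def b_def)
  have eb: "matvec M W b i = Im l * a i + Re l * b i" if "i < M" for i
    using arg_cong[OF e[OF that], of Im] by (simp add: matvec_def a_def b_def algebra_simps)
  have "(\<Sum>i<M. (Re l * a i - Im l * b i) * b i) = (\<Sum>i<M. a i * (Im l * a i + Re l * b i))"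
    using matvec_adjoint[OF assms(1), of a b] ea eb by simp
  then have "Im l * (\<Sum>i<M. (a i)\<^sup>2 + (b i)\<^sup>2) = 0"
    by (simp add: sum_distrib_left algebra_simps power2_eq_square sum.distrib sum_subtractf)
  moreover have "(\<Sum>i<M. (a i)\<^sup>2 + (b i)\<^sup>2) \<noteq> 0"
  proof
    assume "(\<Sum>i<M. (a i)\<^sup>2 + (b i)\<^sup>2) = 0"
    then have "\<forall>i<M. (a i)\<^sup>2 + (b i)\<^sup>2 = 0"
      by (subst (asm) sum_nonneg_eq_0_iff) auto
    then have "\<forall>i<M. v $ i = 0" by (auto simp: a_def b_def complex_eq_iff sum_power2_eq_zero_iff)
    then show False using v by (auto simp: vec_eq_iff)
  qed
  ultimately have "Im l = 0" by simp
  then show ?thesis by (simp add: complex_is_Real_iff)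
qed

lemma size_proots_char_poly_symmetric:
  assumes "symmetric_on M W"
  shows "size (proots (char_poly W)) = M"
proof -
  have W: "W \<in> carrier_mat M M" using assms by (simp add: symmetric_on_def)
  have "degree (char_poly W) = M" "char_poly W \<noteq> 0"
    using degree_monic_char_poly[OF W] by auto
  then show ?thesis
    using size_proots_eq_degree_if_real_roots[of "char_poly W"]
      complex_eigenvalue_symmetric_real[OF assms] by auto
qed

text \<open>Let \<open>P\<close> be the identity matrix with columns \<open>0\<close> and \<open>q\<close> replaced by the eigenvectors. Then columns
  \<open>0\<close> and \<open>q\<close> of \<open>(x I - W) P\<close> are divisible by \<open>x - l\<close>.\<close>

lemma square_dvd_char_poly:
  fixes W :: "real mat"
  assumes W: "W \<in> carrier_mat M M"
    and u: "\<And>i. i < M \<Longrightarrow> u i \<noteq> 0" "\<And>i. i < M \<Longrightarrow> matvec M W u i = l * u i"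
    and y: "q < M" "0 < q" "y q \<noteq> 0" "y 0 = 0" "\<And>i. i < M \<Longrightarrow> matvec M W y i = l * y i"
  shows "[:- l, 1:]\<^sup>2 dvd char_poly W"
proof -
  define P where "P = mat M M (\<lambda>(i,j). if j = 0 then u i else if j = q then y i else if i = j then 1 else 0)"
  have P: "P \<in> carrier_mat M M" by (simp add: P_def)
  have "det P \<noteq> 0"
  proof
    assume "det P = 0"
    then obtain v where v: "v \<in> carrier_vec M" "v \<noteq> 0\<^sub>v M" "P *\<^sub>v v = 0\<^sub>v M"
      using det_0_iff_vec_prod_zero_field[OF P] by auto
    have row: "u i * v $ 0 + y i * v $ q + (if i = 0 \<or> i = q then 0 else v $ i) = 0" if "i < M" for i
    proof -
      have "0 = (P *\<^sub>v v) $ i" using v that by simp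
      also have "\<dots> = (\<Sum>j<M. (if j = 0 then u i else if j = q then y i else if i = j then 1 else 0) * v $ j)"
        unfolding mult_mat_vec_eq_sum[OF P v(1) that] using that by (simp add: P_def)
      also have "\<dots> = (\<Sum>j<M. (if j = 0 then u i * v $ 0 else 0) + (if j = q then y i * v $ q else 0)
          + (if j = i then (if i = 0 \<or> i = q then 0 else v $ i) else 0))"
        using y by (intro sum.cong refl) auto
      also have "\<dots> = u i * v $ 0 + y i * v $ q + (if i = 0 \<or> i = q then 0 else v $ i)"
        using y that by (simp add: sum.distrib)
      finally show ?thesis by simp
    qed
    \<comment> \<open>The order matters: since \<open>y 0 = 0\<close>, row 0 involves
      \<open>v $ 0\<close> alone; row \<open>q\<close> then involves \<open>v $ q\<close> alone, and
      each other row its own diagonal entry.\<close>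
    have v0: "v $ 0 = 0" using row[of 0] y u(1)[of 0] by auto
    have vq: "v $ q = 0" using row[of q] y v0 by auto
    have "v $ i = 0" if "i < M" for i using row[OF that] v0 vq by (auto split: if_splits)
    then show False using v by (auto simp: vec_eq_iff)
  qed
  define X where "X = char_poly_matrix W"
  have X: "X \<in> carrier_mat M M" using W by (simp add: X_def char_poly_matrix_def)
  define cP where "cP = map_mat (\<lambda>a. [:a:]) P"
  have cP: "cP \<in> carrier_mat M M" using P by (simp add: cP_def)
  define dg where "dg = (\<lambda>j. if j = 0 \<or> j = q then [:-l, 1:] else 1)"
  define Dg where "Dg = mat M M (\<lambda>(i,j). if i = j then dg j else 0)"
  have Dg: "Dg \<in> carrier_mat M M" by (simp add: Dg_def)
  define C where "C = mat M M (\<lambda>(i,j). if j = 0 then [:u i:] else if j = q then [:y i:] else X $$ (i, j))"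
  have C: "C \<in> carrier_mat M M" by (simp add: C_def)
  have XP: "X $$ (i, j) = (if i = j then [:0,1:] else 0) - [:W $$ (i,j):]" if "i < M" "j < M" for i j
    using that W by (auto simp: X_def char_poly_matrix_def)
  \<comment> \<open>For an eigenvector w, (x I - W) w = (x - l) w, read entrywise over
    polynomials.\<close>
  have col: "(\<Sum>k<M. X $$ (i, k) * [:w k:]) = [:w i:] * [:-l, 1:]"
    if "i < M" "\<And>i. i < M \<Longrightarrow> matvec M W w i = l * w i" for i and w :: "nat \<Rightarrow> real"
  proof -
    have "(\<Sum>k<M. X $$ (i, k) * [:w k:]) = (\<Sum>k<M. (if k = i then [:0,1:] * [:w i:] else 0) - [:W $$ (i,k) * w k:])"
      using that(1) by (intro sum.cong refl) (auto simp: XP left_diff_distrib)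
    also have "\<dots> = [:0,1:] * [:w i:] - [:matvec M W w i:]"
      using that(1) by (simp add: sum_subtractf matvec_def sum_to_poly)
    finally show ?thesis using that by simp
  qed
  have eq: "X * cP = C * Dg"
  proof (rule eq_matI)
    show "dim_row (X * cP) = dim_row (C * Dg)" "dim_col (X * cP) = dim_col (C * Dg)"
      using X cP C Dg by auto
    fix i j assume "i < dim_row (C * Dg)" "j < dim_col (C * Dg)"
    then have ij: "i < M" "j < M" using C Dg by auto
    have l: "(X * cP) $$ (i, j) = (\<Sum>k<M. X $$ (i, k) * [:P $$ (k, j):])"
      using ij X cP P by (auto simp: scalar_prod_def atLeast0LessThan cP_def)
    have "(C * Dg) $$ (i, j) = (\<Sum>k<M. C $$ (i, k) * (if k = j then dg j else 0))"
      using ij C Dg by (auto simp: scalar_prod_def atLeast0LessThan Dg_def)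
    also have "\<dots> = C $$ (i, j) * dg j"
      using ij by (simp add: if_distrib[of "\<lambda>x. _ * x"] cong: if_cong)
    finally have r: "(C * Dg) $$ (i, j) = C $$ (i, j) * dg j" .
    consider "j = 0" | "j = q" | "j \<noteq> 0" "j \<noteq> q" by blast
    then show "(X * cP) $$ (i, j) = (C * Dg) $$ (i, j)"
    proof cases
      case 1
      then show ?thesis unfolding l r using col[OF ij(1) u(2)] ij by (simp add: P_def C_def dg_def)
    next
      case 2
      then show ?thesis unfolding l r using col[OF ij(1) y(5)] ij y by (simp add: P_def C_def dg_def)
    next
      case 3
      have "(\<Sum>k<M. X $$ (i, k) * [:P $$ (k, j):]) = (\<Sum>k<M. if k = j then X $$ (i, j) else 0)"
        using 3 ij by (intro sum.cong refl) (auto simp: P_def one_pCons[symmetric])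
      then show ?thesis unfolding l r using 3 ij by (simp add: C_def dg_def)
    qed
  qed
  have "det X * det cP = det C * det Dg"
    using arg_cong[OF eq, of det] det_mult[OF X cP] det_mult[OF C Dg] by simp
  moreover have "det cP = [:det P:]"
  proof -
    interpret const: comm_ring_hom "\<lambda>a :: real. [:a:]"
      by unfold_locales (auto simp: one_pCons)
    show ?thesis unfolding cP_def by (rule const.hom_det)
  qed
  moreover have "det Dg = [:-l, 1:]\<^sup>2"
  proof -
    have "det Dg = prod_list (diag_mat Dg)"
      by (rule det_upper_triangular[OF _ Dg]) (auto simp: Dg_def upper_triangular_def)
    also have "\<dots> = (\<Prod>j<M. dg j)"
      by (simp add: prod_list_diag_prod Dg_def atLeast0LessThan)
    also have "\<dots> = (\<Prod>j\<in>{0, q}. dg j)"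
      using y by (intro prod.mono_neutral_right) (auto simp: dg_def)
    also have "\<dots> = [:-l, 1:]\<^sup>2" using y by (simp add: dg_def power2_eq_square)
    finally show ?thesis .
  qed
  ultimately have "Polynomial.smult (det P) (char_poly W) = det C * [:-l, 1:]\<^sup>2"
    by (simp add: char_poly_def X_def)
  then have "[:-l, 1:]\<^sup>2 dvd Polynomial.smult (det P) (char_poly W)" by simp
  then show ?thesis using \<open>det P \<noteq> 0\<close> by (simp add: dvd_smult_iff)
qed

subsection \<open>Contraction of the dispersion by a doubly stochastic matrix\<close>

lemma sym_doubly_stochasticD:
  assumes "sym_doubly_stochastic M W"
  shows "symmetric_on M W" and "W \<in> carrier_mat M M"
    and "\<And>i. i < M \<Longrightarrow> matvec M W (\<lambda>_. 1) i = 1"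
proof -
  have W: "W \<in> carrier_mat M M" "transpose_mat W = W"
    using assms by (auto simp: sym_doubly_stochastic_def)
  have "W $$ (i, j) = W $$ (j, i)" if "i < M" "j < M" for i j
    using W that index_transpose_mat(1)[of j W i] by auto
  then show "symmetric_on M W" using W by (simp add: symmetric_on_def)
  show "W \<in> carrier_mat M M" by fact
  show "\<And>i. i < M \<Longrightarrow> matvec M W (\<lambda>_. 1) i = 1"
    using assms by (simp add: sym_doubly_stochastic_def matvec_def)
qed

text \<open>Positions start at 0 here, so \<open>eigval W i\<close> is the entry at
  \<open>i - 1\<close>, and \<open>mixing_rate\<close> looks at the entries 1 and
  \<open>M - 1\<close>.\<close>

definition eigval_list :: "real mat \<Rightarrow> real list" where
  "eigval_list W = rev (sorted_list_of_multiset (proots (char_poly W)))"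

lemma eigval_list:
  assumes "symmetric_on M W"
  shows "length (eigval_list W) = M" and "mset (eigval_list W) = proots (char_poly W)"
    and "\<And>i j. i \<le> j \<Longrightarrow> j < M \<Longrightarrow> eigval_list W ! j \<le> eigval_list W ! i"
    and "mixing_rate W = max \<bar>eigval_list W ! 1\<bar> \<bar>eigval_list W ! (M - 1)\<bar>"
proof -
  show m: "mset (eigval_list W) = proots (char_poly W)"
    unfolding eigval_list_def by simp
  have "size (mset (eigval_list W)) = M"
    unfolding m by (rule size_proots_char_poly_symmetric[OF assms])
  then show len: "length (eigval_list W) = M" by simp
  have "sorted (rev (eigval_list W))" unfolding eigval_list_def by simp
  then show "eigval_list W ! j \<le> eigval_list W ! i" if "i \<le> j" "j < M" for i j
    using that sorted_rev_nth_mono[of "eigval_list W" i j] unfolding len by blast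
  have "dim_row W = M" using assms by (auto simp: symmetric_on_def)
  then show "mixing_rate W = max \<bar>eigval_list W ! 1\<bar> \<bar>eigval_list W ! (M - 1)\<bar>"
    by (simp add: mixing_rate_def eigval_def eigval_list_def)
qed

lemma set_eigval_list:
  assumes "W \<in> carrier_mat M M"
  shows "set_mset (proots (char_poly W)) = {x. poly (char_poly W) x = (0::real)}"
  using degree_monic_char_poly[OF assms] by (intro set_count_proots) auto

text \<open>If \<open>M = 1\<close>, the only root is 1, and it is also the last entry of the list,
  which \<open>mixing_rate\<close> takes into account; the rate would be at least 1.\<close>

lemma mixing_rate_less_one_imp_two_le:
  assumes "sym_doubly_stochastic M W" and "M \<ge> 1" and "mixing_rate W < 1"
  shows "M \<ge> 2"
proof (rule ccontr)
  assume "\<not> M \<ge> 2"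
  then have M: "M = 1" using assms(2) by simp
  note W = sym_doubly_stochasticD[OF assms(1)]
  note l = eigval_list[OF W(1)]
  have "poly (char_poly W) 1 = 0"
    unfolding eigenvalue_iff_matvec[OF W(2)] using W(3) M by (intro exI[of _ "\<lambda>_. 1"]) auto
  then have "1 \<in> set (eigval_list W)" unfolding set_mset_mset[symmetric] l(2) set_eigval_list[OF W(2)] by simp
  then have "eigval_list W ! 0 = 1" using l(1) M by (auto simp: in_set_conv_nth)
  then show False using l(4) M assms(3) by simp
qed

text \<open>Entries after position 0 are at most entry 1, hence below 1, so the eigenvalue 1 of the
  constants occupies position 0 and no other. If \<open>\<mu>\<close> were 1, the constants and
  \<open>y\<close> would make 1 a double root, which puts a second 1 at a later position. Thus
  \<open>\<mu>\<close> itself sits at a later position, between the last entry and entry 1.\<close>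

lemma abs_eigenvalue_le_mixing_rate:
  assumes W: "sym_doubly_stochastic M W" and "M \<ge> 2" and rho: "mixing_rate W < 1"
    and y: "p < M" "y p \<noteq> 0" "(\<Sum>i<M. y i) = 0" "\<And>i. i < M \<Longrightarrow> matvec M W y i = \<mu> * y i"
  shows "\<bar>\<mu>\<bar> \<le> mixing_rate W"
proof -
  note W = sym_doubly_stochasticD[OF W]
  note l = eigval_list[OF W(1)]
  have set_l: "x \<in> set (eigval_list W) \<longleftrightarrow> poly (char_poly W) x = 0" for x
    unfolding set_mset_mset[symmetric] l(2) set_eigval_list[OF W(2)] by simp
  have "0 < M" using assms(2) by simp
  have one: "1 \<in> set (eigval_list W)" unfolding set_l eigenvalue_iff_matvec[OF W(2)]
    by (rule exI[of _ "\<lambda>_. 1"]) (use W(3) \<open>0 < M\<close> in auto)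
  have small: "eigval_list W ! i < 1" if "1 \<le> i" "i < M" for i
    using l(3)[OF that] l(4) rho by linarith
  have l0: "eigval_list W ! 0 = 1"
  proof -
    obtain i where "i < M" "eigval_list W ! i = 1" using one l(1) by (auto simp: in_set_conv_nth)
    then show ?thesis using small[of i] by (cases i) auto
  qed
  have "\<mu> \<in> set (eigval_list W)" unfolding set_l eigenvalue_iff_matvec[OF W(2)] using y by blast
  moreover have "\<mu> \<noteq> 1"
  proof
    assume mu: "\<mu> = 1"
    \<comment> \<open>Subtracting a multiple of the constant eigenvector clears the entry at 0, as
      \<open>square_dvd_char_poly\<close> demands. The result is nonzero because a constant vector
      of sum zero vanishes.\<close>
    define y' where "y' = (\<lambda>i. y i - y 0)"
    have "\<exists>q<M. y' q \<noteq> 0"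
    proof (rule ccontr)
      assume "\<not> ?thesis"
      then have const: "y i = y 0" if "i < M" for i
        using that by (metis (no_types, lifting) eq_iff_diff_eq_0 y'_def)
      have "(\<Sum>i<M. y i) = (\<Sum>i<M. y 0)" by (intro sum.cong refl const) simp
      then have "y 0 = 0" using y(3) assms(2) by simp
      then show False using const[OF y(1)] y(2) by simp
    qed
    then obtain q where q: "q < M" "y' q \<noteq> 0" by blast
    have "[:- 1, 1:]\<^sup>2 dvd char_poly W"
    proof (rule square_dvd_char_poly[OF W(2), where u = "\<lambda>_. 1" and y = y' and q = q])
      show "matvec M W y' i = 1 * y' i" if "i < M" for i
        using y(4)[OF that] W(3)[OF that] unfolding mu
        by (simp add: y'_def matvec_def right_diff_distrib sum_subtractf flip: sum_distrib_right)
      show "0 < q" using q by (auto simp: y'_def intro: gr0I)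
    qed (use q W(3) in \<open>auto simp: y'_def\<close>)
    moreover have "char_poly W \<noteq> 0" using degree_monic_char_poly[OF W(2)] by auto
    ultimately have "count (mset (eigval_list W)) 1 \<ge> 2"
      unfolding l(2) count_proots[OF \<open>char_poly W \<noteq> 0\<close>] by (simp only: order_divides) blast
    moreover have "eigval_list W = 1 # tl (eigval_list W)"
      using l0 l(1) \<open>0 < M\<close> by (metis hd_conv_nth length_0_conv list.collapse less_irrefl)
    then have "count (mset (eigval_list W)) 1 = Suc (count (mset (tl (eigval_list W))) 1)"
      by (metis count_add_mset mset.simps(2))
    ultimately have "count (mset (tl (eigval_list W))) 1 > 0" by linarith
    then have "1 \<in> set (tl (eigval_list W))" by (simp only: count_greater_zero_iff set_mset_mset)
    then obtain i where "i < length (tl (eigval_list W))" "tl (eigval_list W) ! i = 1" by (auto simp: in_set_conv_nth)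
    moreover from this have "Suc i < M" using l(1) by simp
    ultimately show False using small[of "Suc i"] l(1) by (simp add: nth_tl)
  qed
  ultimately obtain i where i: "i < M" "eigval_list W ! i = \<mu>" "i \<noteq> 0"
    using l0 l(1) by (auto simp: in_set_conv_nth)
  then have "eigval_list W ! (M - 1) \<le> \<mu>" "\<mu> \<le> eigval_list W ! 1" using l(3)[of i "M - 1"] l(3)[of 1 i] by auto
  then show ?thesis unfolding l(4) by linarith
qed

section \<open>The extremal eigenvector on vectors of sum zero\<close>

lemma compact_unit_sphere_fun:
  "compact {y :: nat \<Rightarrow> real. (\<forall>i\<ge>M. y i = 0) \<and> (\<Sum>i<M. (y i)\<^sup>2) = 1 \<and> (\<Sum>i<M. y i) = 0}"
proof -
  \<comment> \<open>Coordinates from \<open>M\<close> on are pinned to 0, so the set lies in a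
    product of compact sets over all indices and Tychonoff's theorem applies.\<close>
  define K where "K = (\<lambda>i. if i < M then {-1..1::real} else {0})"
  have "compactin (product_topology (\<lambda>_. euclidean) UNIV) (PiE UNIV K)"
    unfolding compactin_PiE by (auto simp: K_def)
  then have K: "compact (PiE UNIV K)"
    by (simp add: euclidean_product_topology)
  have cont: "continuous_on UNIV (\<lambda>y :: nat \<Rightarrow> real. y i)" for i
    by (rule continuous_on_product_coordinates)
  have "closed {y :: nat \<Rightarrow> real. (\<Sum>i<M. (y i)\<^sup>2) = 1}" "closed {y :: nat \<Rightarrow> real. (\<Sum>i<M. y i) = 0}"
    by (intro closed_Collect_eq continuous_intros cont)+
  then have "compact (PiE UNIV K \<inter> ({y. (\<Sum>i<M. (y i)\<^sup>2) = 1} \<inter> {y. (\<Sum>i<M. y i) = 0}))"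
    by (intro compact_Int_closed K closed_Int)
  also have "PiE UNIV K \<inter> ({y. (\<Sum>i<M. (y i)\<^sup>2) = 1} \<inter> {y. (\<Sum>i<M. y i) = 0}) =
    {y. (\<forall>i\<ge>M. y i = 0) \<and> (\<Sum>i<M. (y i)\<^sup>2) = 1 \<and> (\<Sum>i<M. y i) = 0}"
  proof -
    have "\<bar>y i\<bar> \<le> 1" if "(\<Sum>i<M. (y i)\<^sup>2) = 1" "i < M" for y :: "nat \<Rightarrow> real" and i
    proof -
      have "(y i)\<^sup>2 \<le> (\<Sum>i<M. (y i)\<^sup>2)" using that(2) by (intro member_le_sum) auto
      then show ?thesis using that(1) by (simp add: abs_square_le_1)
    qed
    then show ?thesis by (fastforce simp: K_def PiE_def Pi_def abs_le_iff split: if_splits)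
  qed
  finally show ?thesis .
qed

lemma sum_power2_add_scaled:
  fixes a b :: "'i \<Rightarrow> real"
  shows "(\<Sum>i\<in>I. (a i + e * b i)\<^sup>2) = (\<Sum>i\<in>I. (a i)\<^sup>2) + 2 * e * (\<Sum>i\<in>I. a i * b i) + e\<^sup>2 * (\<Sum>i\<in>I. (b i)\<^sup>2)"
proof -
  have "(a i + e * b i)\<^sup>2 = (a i)\<^sup>2 + 2 * e * (a i * b i) + e\<^sup>2 * (b i)\<^sup>2" for i
    by (simp add: power2_eq_square algebra_simps)
  then show ?thesis by (simp add: sum.distrib sum_distrib_left)
qed

text \<open>Maximise |Wy|^2 over the unit vectors of sum zero. At a maximiser \<open>y0\<close> with
  maximum \<open>\<mu>\<^sup>2\<close>, stationarity gives W W y0 = mu^2 y0, that is (W - mu) (W +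
  mu) y0 = 0. Either (W + mu) y0 is a nonzero eigenvector for mu, or \<open>y0\<close> is one for
  -mu; the square, and with it the bound, is the same in both cases.\<close>

lemma matvec_bound_by_eigenvalue:
  assumes W: "sym_doubly_stochastic M W" and "M \<ge> 2"
  obtains y \<mu> p where "p < M" "y p \<noteq> 0" "(\<Sum>i<M. y i) = 0" "\<And>i. i < M \<Longrightarrow> matvec M W y i = \<mu> * y i"
    and "\<And>x. (\<Sum>i<M. x i) = 0 \<Longrightarrow> (\<Sum>i<M. (matvec M W x i)\<^sup>2) \<le> \<mu>\<^sup>2 * (\<Sum>i<M. (x i)\<^sup>2)"
proof -
  note W = sym_doubly_stochasticD[OF W]
  let ?W = "matvec M W"
  let ?ip = "\<lambda>x y :: nat \<Rightarrow> real. \<Sum>i<M. x i * y i"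
  have lin: "?W (\<lambda>i. a * x i + b * y i) i = a * ?W x i + b * ?W y i" for a b x y i
    by (simp add: matvec_def sum.distrib sum_distrib_left algebra_simps)
  have Wsum: "(\<Sum>i<M. ?W x i) = (\<Sum>i<M. x i)" for x
    using matvec_adjoint[OF W(1), of x "\<lambda>_. 1"] W(3) by simp
  have cong: "?W x i = ?W y i" if "\<And>i. i < M \<Longrightarrow> x i = y i" for x y i
    using that by (simp add: matvec_def)
  define S where "S = {y :: nat \<Rightarrow> real. (\<forall>i\<ge>M. y i = 0) \<and> (\<Sum>i<M. (y i)\<^sup>2) = 1 \<and> (\<Sum>i<M. y i) = 0}"
  have cS: "compact S" unfolding S_def by (rule compact_unit_sphere_fun)
  have norm: "(\<lambda>i. if i < M then x i / sqrt (\<Sum>i<M. (x i)\<^sup>2) else 0) \<in> S"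
    if "(\<Sum>i<M. x i) = 0" "(\<Sum>i<M. (x i)\<^sup>2) \<noteq> 0" for x
  proof -
    have "(\<Sum>i<M. (x i)\<^sup>2) > 0" using that(2) by (metis less_le sum_nonneg zero_le_power2)
    then show ?thesis using that
      by (simp add: S_def power_divide flip: sum_divide_distrib)
  qed
  have "S \<noteq> {}"
  proof -
    \<comment> \<open>The difference of the first two unit vectors, available because
      \<open>M \<ge> 2\<close>.\<close>
    let ?x = "\<lambda>i::nat. (if i = 0 then 1 else 0) + (if i = 1 then - 1 else 0) :: real"
    have "(?x 0)\<^sup>2 \<le> (\<Sum>i<M. (?x i)\<^sup>2)" 
      using assms(2) member_le_sum[of 0 "{..<M}" "\<lambda>i. (?x i)\<^sup>2"] by simp
    then have "(\<Sum>i<M. (?x i)\<^sup>2) \<noteq> 0" by auto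
    moreover have "(\<Sum>i<M. ?x i) = 0" using assms(2) by (subst sum.distrib) simp
    ultimately show ?thesis using norm[of ?x] by blast
  qed
  have "continuous_on S (\<lambda>y. \<Sum>i<M. (?W y i)\<^sup>2)"
    unfolding matvec_def
    by (intro continuous_intros continuous_on_subset[OF continuous_on_product_coordinates]) auto
  from continuous_attains_sup[OF cS \<open>S \<noteq> {}\<close> this]
  obtain y0 where y0: "y0 \<in> S" and max: "\<And>y. y \<in> S \<Longrightarrow> (\<Sum>i<M. (?W y i)\<^sup>2) \<le> (\<Sum>i<M. (?W y0 i)\<^sup>2)"
    by blast
  define \<mu> where "\<mu> = sqrt (\<Sum>i<M. (?W y0 i)\<^sup>2)"
  have mu2: "\<mu>\<^sup>2 = (\<Sum>i<M. (?W y0 i)\<^sup>2)" by (simp add: \<mu>_def sum_nonneg)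
  have bound: "(\<Sum>i<M. (?W x i)\<^sup>2) \<le> \<mu>\<^sup>2 * (\<Sum>i<M. (x i)\<^sup>2)" if x: "(\<Sum>i<M. x i) = 0" for x
  proof (cases "(\<Sum>i<M. (x i)\<^sup>2) = 0")
    case True
    then have "x i = 0" if "i < M" for i using that by (subst (asm) sum_nonneg_eq_0_iff) auto
    then have "?W x i = 0" for i by (simp add: matvec_def)
    then show ?thesis by (simp add: True)
  next
    case False
    let ?n = "sqrt (\<Sum>i<M. (x i)\<^sup>2)"
    have n: "?n\<^sup>2 = (\<Sum>i<M. (x i)\<^sup>2)" by (simp add: sum_nonneg)
    let ?x = "\<lambda>i. if i < M then x i / ?n else 0"
    have W': "?W ?x i = ?W x i / ?n" for i
      by (simp add: matvec_def sum_divide_distrib)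
    have "(\<Sum>i<M. (?W x i)\<^sup>2) / ?n\<^sup>2 \<le> \<mu>\<^sup>2"
      using max[OF norm[OF x False]] unfolding W' mu2
      by (simp add: power_divide flip: sum_divide_distrib)
    moreover have "?n\<^sup>2 > 0" unfolding n using False by (metis less_le sum_nonneg zero_le_power2)
    ultimately show ?thesis unfolding n by (simp add: pos_divide_le_eq)
  qed
  have y0': "(\<Sum>i<M. (y0 i)\<^sup>2) = 1" "(\<Sum>i<M. y0 i) = 0" using y0 by (auto simp: S_def)
  define h where "h = (\<lambda>i. \<mu>\<^sup>2 * y0 i - ?W (?W y0) i)"
  have hsum: "(\<Sum>i<M. h i) = 0" by (simp add: h_def sum_subtractf Wsum y0' flip: sum_distrib_left)
  \<comment> \<open>The form \<open>\<mu>\<^sup>2 |x|\<^sup>2 - |Wx|\<^sup>2\<close> is nonnegative and vanishes at \<open>y0\<close>, so its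
    gradient \<open>2 h\<close> at \<open>y0\<close> vanishes.\<close>
  have "?ip h h = 0"
  proof (rule ccontr)
    assume "?ip h h \<noteq> 0"
    moreover have "?ip h h \<ge> 0" by (intro sum_nonneg) simp
    ultimately have pos: "?ip h h > 0" by linarith
    define Q where "Q = \<mu>\<^sup>2 * (\<Sum>i<M. (h i)\<^sup>2) - (\<Sum>i<M. (?W h i)\<^sup>2)"
    have quad: "0 \<le> 2 * e * ?ip h h + e\<^sup>2 * Q" for e
    proof -
      let ?x = "\<lambda>i. y0 i + e * h i"
      have Wx: "?W ?x i = ?W y0 i + e * ?W h i" for i using lin[of 1 y0 e h i] by simp
      have "(\<Sum>i<M. (?W ?x i)\<^sup>2) \<le> \<mu>\<^sup>2 * (\<Sum>i<M. (?x i)\<^sup>2)"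
        by (rule bound) (simp add: sum.distrib hsum y0' flip: sum_distrib_left)
      also have "(\<Sum>i<M. (?x i)\<^sup>2) = 1 + 2 * e * ?ip y0 h + e\<^sup>2 * (\<Sum>i<M. (h i)\<^sup>2)"
        unfolding sum_power2_add_scaled y0'(1) ..
      also have "(\<Sum>i<M. (?W ?x i)\<^sup>2) = \<mu>\<^sup>2 + 2 * e * ?ip (?W y0) (?W h) + e\<^sup>2 * (\<Sum>i<M. (?W h i)\<^sup>2)"
        unfolding Wx mu2 sum_power2_add_scaled ..
      finally have "0 \<le> 2 * e * (\<mu>\<^sup>2 * ?ip y0 h - ?ip (?W y0) (?W h)) + e\<^sup>2 * Q"
        by (simp add: Q_def algebra_simps)
      moreover have "?ip (?W y0) (?W h) = ?ip (?W (?W y0)) h"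
        by (rule matvec_adjoint[OF W(1), symmetric])
      moreover have "?ip h h = (\<Sum>i<M. (\<mu>\<^sup>2 * y0 i - ?W (?W y0) i) * h i)"
        by (rule sum.cong) (auto simp: h_def)
      then have "?ip h h = \<mu>\<^sup>2 * ?ip y0 h - ?ip (?W (?W y0)) h"
        by (simp add: left_diff_distrib sum_subtractf sum_distrib_left mult.assoc)
      ultimately show ?thesis by simp
    qed
    \<comment> \<open>A negative \<open>e\<close> this small lets the linear term of
      \<open>quad\<close> win: the quadratic term is at most -e |h|^2, half of what the linear term
      2 e |h|^2 takes away.\<close>
    define e where "e = - ?ip h h / (\<bar>Q\<bar> + 1)"
    have "e < 0" "e * (\<bar>Q\<bar> + 1) = - ?ip h h" using pos by (auto simp: e_def field_simps)
    have "e\<^sup>2 * Q \<le> e * (e * (\<bar>Q\<bar> + 1))"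
      using mult_left_mono[of Q "\<bar>Q\<bar> + 1" "e\<^sup>2"] by (simp add: power2_eq_square mult.assoc)
    also have "\<dots> = - e * ?ip h h" using \<open>e * (\<bar>Q\<bar> + 1) = _\<close> by simp
    finally have "0 \<le> e * ?ip h h" using quad[of e] by simp
    then show False using \<open>e < 0\<close> pos by (simp add: zero_le_mult_iff)
  qed
  then have h0: "h i = 0" if "i < M" for i
    using that by (subst (asm) sum_nonneg_eq_0_iff) auto
  define y1 where "y1 = (\<lambda>i. ?W y0 i + \<mu> * y0 i)"
  have Wy1: "?W y1 i = \<mu> * y1 i" if "i < M" for i
    using lin[of 1 "?W y0" \<mu> y0 i] h0[OF that]
    by (simp add: y1_def h_def power2_eq_square algebra_simps)
  have y1sum: "(\<Sum>i<M. y1 i) = 0" by (simp add: y1_def sum.distrib Wsum y0' flip: sum_distrib_left)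
  show thesis
  proof (cases "\<exists>p<M. y1 p \<noteq> 0")
    case True
    then obtain p where "p < M" "y1 p \<noteq> 0" by blast
    then show thesis by (rule that[OF _ _ y1sum Wy1 bound])
  next
    case False
    then have Wy0: "?W y0 i = - \<mu> * y0 i" if "i < M" for i
      using that by (simp add: y1_def) (metis add_eq_0_iff2)
    have "\<exists>p<M. y0 p \<noteq> 0"
    proof (rule ccontr)
      assume "\<not> ?thesis"
      then have "(\<Sum>i<M. (y0 i)\<^sup>2) = 0" by simp
      then show False using y0'(1) by simp
    qed
    then obtain p where "p < M" "y0 p \<noteq> 0" by blast
    then show thesis
    proof (rule that[OF _ _ y0'(2) Wy0])
      show "(\<Sum>i<M. (?W x i)\<^sup>2) \<le> (- \<mu>)\<^sup>2 * (\<Sum>i<M. (x i)\<^sup>2)" if "(\<Sum>i<M. x i) = 0" for x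
        using bound[OF that] by simp
    qed
  qed
qed

lemma matvec_contraction:
  assumes W: "sym_doubly_stochastic M W" and "M \<ge> 2" and "mixing_rate W < 1"
    and x: "(\<Sum>i<M. x i) = 0"
  shows "(\<Sum>i<M. (matvec M W x i)\<^sup>2) \<le> (mixing_rate W)\<^sup>2 * (\<Sum>i<M. (x i)\<^sup>2)"
proof (rule matvec_bound_by_eigenvalue[OF W assms(2)])
  fix y \<mu> p
  assume y: "p < M" "y p \<noteq> 0" "(\<Sum>i<M. y i) = 0" "\<And>i. i < M \<Longrightarrow> matvec M W y i = \<mu> * y i"
    and b: "\<And>x. (\<Sum>i<M. x i) = 0 \<Longrightarrow> (\<Sum>i<M. (matvec M W x i)\<^sup>2) \<le> \<mu>\<^sup>2 * (\<Sum>i<M. (x i)\<^sup>2)"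
  have "\<bar>\<mu>\<bar> \<le> \<bar>mixing_rate W\<bar>"
    using abs_eigenvalue_le_mixing_rate[OF assms(1-3) y] by linarith
  then have "\<mu>\<^sup>2 \<le> (mixing_rate W)\<^sup>2" by (simp only: abs_le_square_iff)
  then have "\<mu>\<^sup>2 * (\<Sum>i<M. (x i)\<^sup>2) \<le> (mixing_rate W)\<^sup>2 * (\<Sum>i<M. (x i)\<^sup>2)"
    by (intro mult_right_mono sum_nonneg) auto
  with b[OF x] show ?thesis by linarith
qed

lemma mixing_rate_nonneg: "mixing_rate W \<ge> 0"
  by (simp add: mixing_rate_def)

section \<open>Mixing of vector-valued columns\<close>

lemma sum_mix:
  assumes "sym_doubly_stochastic M W"
  shows "(\<Sum>i<M. mix M W X i) = (\<Sum>i<M. X i)"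
proof -
  have "(\<Sum>i<M. mix M W X i) = (\<Sum>j<M. \<Sum>i<M. W $$ (j, i) *\<^sub>R X j)"
    unfolding mix_def by (rule sum.swap)
  also have "\<dots> = (\<Sum>j<M. X j)"
    using assms by (intro sum.cong refl) (simp add: sym_doubly_stochastic_def flip: scaleR_sum_left)
  finally show ?thesis .
qed

lemma mix_pow_0:
  assumes "W \<in> carrier_mat M M" "i < M"
  shows "mix M (W ^\<^sub>m 0) X i = X i"
proof -
  have "mix M (W ^\<^sub>m 0) X i = (\<Sum>j<M. if j = i then X i else 0)"
    unfolding mix_def using assms by (intro sum.cong) auto
  then show ?thesis using assms by simp
qed

lemma mix_pow_Suc:
  assumes "W \<in> carrier_mat M M" "i < M"
  shows "mix M (W ^\<^sub>m Suc t) X i = mix M W (mix M (W ^\<^sub>m t) X) i"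
proof -
  have A: "W ^\<^sub>m t \<in> carrier_mat M M" using assms by simp
  have "(W ^\<^sub>m Suc t) $$ (j, i) = (\<Sum>k<M. (W ^\<^sub>m t) $$ (j, k) * W $$ (k, i))" if "j < M" for j
    using A assms that by (auto simp: scalar_prod_def atLeast0LessThan)
  then have "mix M (W ^\<^sub>m Suc t) X i = (\<Sum>j<M. \<Sum>k<M. ((W ^\<^sub>m t) $$ (j, k) * W $$ (k, i)) *\<^sub>R X j)"
    by (simp add: mix_def scaleR_sum_left)
  also have "\<dots> = (\<Sum>k<M. \<Sum>j<M. ((W ^\<^sub>m t) $$ (j, k) * W $$ (k, i)) *\<^sub>R X j)"
    by (rule sum.swap)
  finally show ?thesis by (simp add: mix_def scaleR_sum_right mult.commute)
qed

lemma mix_cong: "(\<And>j. j < M \<Longrightarrow> X j = Y j) \<Longrightarrow> mix M A X i = mix M A Y i"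
  by (simp add: mix_def)

lemma sum_mix_pow:
  assumes "sym_doubly_stochastic M W"
  shows "(\<Sum>i<M. mix M (W ^\<^sub>m t) X i) = (\<Sum>i<M. X i)"
proof (induction t)
  case 0
  show ?case by (intro sum.cong refl mix_pow_0[OF sym_doubly_stochasticD(2)[OF assms]]) simp
next
  case (Suc t)
  have "(\<Sum>i<M. mix M (W ^\<^sub>m Suc t) X i) = (\<Sum>i<M. mix M W (mix M (W ^\<^sub>m t) X) i)"
    by (intro sum.cong refl mix_pow_Suc[OF sym_doubly_stochasticD(2)[OF assms]]) auto
  then show ?case using sum_mix[OF assms] Suc by metis
qed

text \<open>Mixing acts on every \<open>Basis\<close> coordinate of the columns separately, as
  \<open>W\<close> itself because of symmetry, so the scalar contraction can be summed over the
  coordinates.\<close>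

lemma mix_contraction:
  fixes X :: "nat \<Rightarrow> 'c::euclidean_space"
  assumes W: "sym_doubly_stochastic M W" and "M \<ge> 2" and "mixing_rate W < 1"
    and X: "(\<Sum>i<M. X i) = 0"
  shows "(\<Sum>i<M. (norm (mix M W X i))\<^sup>2) \<le> (mixing_rate W)\<^sup>2 * (\<Sum>i<M. (norm (X i))\<^sup>2)"
proof -
  have sq: "(norm x)\<^sup>2 = (\<Sum>b\<in>Basis. (inner x b)\<^sup>2)" for x :: 'c
    unfolding power2_norm_eq_inner by (subst euclidean_inner) (simp add: power2_eq_square)
  have sym: "symmetric_on M W" using sym_doubly_stochasticD[OF W] by simp
  have "(\<Sum>i<M. (norm (mix M W X i))\<^sup>2) = (\<Sum>i<M. \<Sum>b\<in>Basis. (matvec M W (\<lambda>j. inner (X j) b) i)\<^sup>2)"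
    using sym unfolding sq mix_def matvec_def symmetric_on_def
    by (intro sum.cong refl) (auto simp: inner_sum_left intro!: arg_cong[of _ _ "\<lambda>x. x\<^sup>2"] sum.cong)
  also have "\<dots> = (\<Sum>b\<in>Basis. \<Sum>i<M. (matvec M W (\<lambda>j. inner (X j) b) i)\<^sup>2)"
    by (rule sum.swap)
  also have "\<dots> \<le> (\<Sum>b\<in>Basis. (mixing_rate W)\<^sup>2 * (\<Sum>i<M. (inner (X i) b)\<^sup>2))"
    by (intro sum_mono matvec_contraction[OF assms(1-3)]) (simp add: X flip: inner_sum_left)
  also have "\<dots> = (mixing_rate W)\<^sup>2 * (\<Sum>i<M. (norm (X i))\<^sup>2)"
    unfolding sq sum_distrib_left[symmetric] by (subst sum.swap) simp
  finally show ?thesis .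
qed

text \<open>Each round preserves the sum of the columns, so the one-round contraction can be
  iterated and its factors multiply.\<close>

lemma mix_pow_contraction:
  fixes X :: "nat \<Rightarrow> 'c::euclidean_space"
  assumes W: "sym_doubly_stochastic M W" and "M \<ge> 2" and "mixing_rate W < 1"
    and X: "(\<Sum>i<M. X i) = 0"
  shows "(\<Sum>i<M. (norm (mix M (W ^\<^sub>m t) X i))\<^sup>2) \<le> (mixing_rate W ^ t)\<^sup>2 * (\<Sum>i<M. (norm (X i))\<^sup>2)"
proof (induction t)
  case 0
  have "(\<Sum>i<M. (norm (mix M (W ^\<^sub>m 0) X i))\<^sup>2) = (\<Sum>i<M. (norm (X i))\<^sup>2)"
    by (intro sum.cong refl) (simp only: lessThan_iff mix_pow_0[OF sym_doubly_stochasticD(2)[OF W]])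
  then show ?case by simp
next
  case (Suc t)
  have "(\<Sum>i<M. (norm (mix M (W ^\<^sub>m Suc t) X i))\<^sup>2) = (\<Sum>i<M. (norm (mix M W (mix M (W ^\<^sub>m t) X) i))\<^sup>2)"
    by (intro sum.cong refl) (simp only: lessThan_iff mix_pow_Suc[OF sym_doubly_stochasticD(2)[OF W]])
  also have "\<dots> \<le> (mixing_rate W)\<^sup>2 * (\<Sum>i<M. (norm (mix M (W ^\<^sub>m t) X i))\<^sup>2)"
    by (intro mix_contraction[OF assms(1-3)]) (simp only: sum_mix_pow[OF W] X)
  also have "\<dots> \<le> (mixing_rate W)\<^sup>2 * ((mixing_rate W ^ t)\<^sup>2 * (\<Sum>i<M. (norm (X i))\<^sup>2))"
    by (intro mult_left_mono Suc) simp
  finally show ?case by (simp add: power_mult_distrib mult.assoc)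
qed

subsection \<open>Joint measurability of partial gradients\<close>

text \<open>Replace \<open>x\<close> by the first point of a dense sequence within distance 1 / (n +
  1). The approximation takes countably many values in the first argument, so it is jointly
  measurable; continuity makes it converge pointwise.\<close>

lemma caratheodory_measurable:
  fixes f :: "'a::{metric_space,second_countable_topology} \<Rightarrow> 's \<Rightarrow> 'c::metric_space"
  assumes meas: "\<And>x. f x \<in> borel_measurable M"
    and cont: "\<And>s. s \<in> space M \<Longrightarrow> continuous_on UNIV (\<lambda>x. f x s)"
  shows "(\<lambda>(x, s). f x s) \<in> borel_measurable (borel \<Otimes>\<^sub>M M)"
proof -
  obtain S :: "'a set" where S: "countable S" "\<And>X. open X \<Longrightarrow> X \<noteq> {} \<Longrightarrow> \<exists>d\<in>S. d \<in> X"
    using countable_dense_setE by blast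
  define d where "d = from_nat_into S"
  define idx where "idx = (\<lambda>n x. LEAST j. dist (d j) x < inverse (real (Suc n)))"
  have ex: "\<exists>j. dist (d j) x < e" if "e > 0" for x e
  proof -
    have "\<exists>s\<in>S. s \<in> ball x e" using that by (intro S(2)) auto
    then obtain s where "s \<in> S" "s \<in> ball x e" by blast
    moreover then obtain j where "d j = s" using from_nat_into_surj[OF S(1)] unfolding d_def by blast
    ultimately show ?thesis by (metis dist_commute mem_ball)
  qed
  have idx: "dist (d (idx n x)) x < inverse (real (Suc n))" for n x
    using LeastI_ex[OF ex[of "inverse (real (Suc n))" x]] unfolding idx_def by simp
  show ?thesis
  proof (rule borel_measurable_LIMSEQ_metric)
    fix n
    have [measurable]: "idx n \<in> borel \<rightarrow>\<^sub>M count_space UNIV"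
      unfolding idx_def by measurable
    have [measurable]: "(\<lambda>p. f (d i) (snd p)) \<in> borel_measurable (borel \<Otimes>\<^sub>M M)" for i
      using meas by measurable
    show "(\<lambda>p. f (d (idx n (fst p))) (snd p)) \<in> borel_measurable (borel \<Otimes>\<^sub>M M)"
      by (rule measurable_compose_countable[where f = "\<lambda>i p. f (d i) (snd p)"]) measurable
  next
    fix p :: "'a \<times> 's" assume "p \<in> space (borel \<Otimes>\<^sub>M M)"
    then obtain x s where p: "p = (x, s)" "s \<in> space M" by (auto simp: space_pair_measure)
    have "(\<lambda>n. dist (d (idx n x)) x) \<longlonglongrightarrow> 0"
      by (rule tendsto_sandwich[OF _ _ tendsto_const LIMSEQ_inverse_real_of_nat])
        (simp, intro always_eventually allI less_imp_le[OF idx])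
    then have "(\<lambda>n. d (idx n x)) \<longlonglongrightarrow> x" by (simp add: tendsto_dist_iff[of _ x])
    moreover have "isCont (\<lambda>x. f x s) x" using cont[OF p(2)] by (simp add: continuous_on_eq_continuous_at)
    ultimately show "(\<lambda>n. f (d (idx n (fst p))) (snd p)) \<longlonglongrightarrow> (case p of (x, s) \<Rightarrow> f x s)"
      unfolding p by (auto dest: isCont_tendsto_compose)
  qed
qed

text \<open>Limits of difference quotients along a sequence transfer measurability to the gradient.
  As \<open>gradient\<close> is a definite description, existence and uniqueness of the representing
  vector come first: its coordinates are the values of the derivative on the basis.\<close>

lemma inner_gradient_LIMSEQ:
  fixes h :: "'a::euclidean_space \<Rightarrow> real"
  assumes "h differentiable (at x)"
  shows "(\<lambda>n. (h (x + inverse (real (Suc n)) *\<^sub>R b) - h x) / inverse (real (Suc n)))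
    \<longlonglongrightarrow> inner (gradient h x) b"
proof -
  obtain D where D: "(h has_derivative D) (at x)" using assms by (auto simp: differentiable_def)
  then interpret D: bounded_linear D by (rule has_derivative_bounded_linear)
  define d where "d = (\<Sum>b\<in>Basis. D b *\<^sub>R b)"
  have "D v = inner v d" for v
  proof -
    have "D v = D (\<Sum>b\<in>Basis. inner v b *\<^sub>R b)" by (simp add: euclidean_representation)
    also have "\<dots> = (\<Sum>b\<in>Basis. inner v b * D b)" by (simp add: D.sum D.scaleR)
    finally show ?thesis by (simp add: d_def inner_sum_right mult.commute)
  qed
  then have g: "gderiv h x d" using D unfolding gderiv_def by (metis (full_types) ext)
  have "d' = d" if "gderiv h x d'" for d'
  proof -
    have "(\<lambda>v. inner v d') = (\<lambda>v. inner v d)"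
      using that g unfolding gderiv_def by (rule has_derivative_unique)
    then have "inner v (d' - d) = 0" for v by (simp add: inner_diff_right) (metis right_minus_eq)
    then show ?thesis by (metis inner_eq_zero_iff right_minus_eq)
  qed
  with g have "gradient h x = d" unfolding gradient_def by (intro the_equality)
  then have "(h has_derivative (\<lambda>v. inner v (gradient h x))) (at x)"
    using g by (simp add: gderiv_def)
  then have "((\<lambda>t. h (x + t *\<^sub>R b)) has_derivative (\<lambda>t. inner (t *\<^sub>R b) (gradient h x))) (at 0)"
    by (intro has_derivative_compose[of "\<lambda>t. x + t *\<^sub>R b" _ 0 UNIV h, simplified])
      (auto intro!: derivative_eq_intros)
  then have "((\<lambda>t. h (x + t *\<^sub>R b)) has_field_derivative inner (gradient h x) b) (at 0)"
    by (simp add: has_field_derivative_def inner_commute mult.commute[of _ "inner _ _"])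
  then have "((\<lambda>t. (h (x + t *\<^sub>R b) - h x) / t) \<longlongrightarrow> inner (gradient h x) b) (at 0)"
    by (simp add: DERIV_def)
  moreover have "filterlim (\<lambda>n. inverse (real (Suc n))) (at 0) sequentially"
    unfolding filterlim_at using LIMSEQ_inverse_real_of_nat by (auto intro!: always_eventually)
  ultimately show ?thesis by (rule filterlim_compose)
qed

text \<open>The base point depends on the parameter because each block of \<open>saddle_grad\<close>
  is differentiated at a varying point, the parameter being the pair of full point and
  sample.\<close>

lemma borel_measurable_gradient:
  fixes h :: "'a::euclidean_space \<Rightarrow> 'p \<Rightarrow> real"
  assumes h: "(\<lambda>(u, p). h u p) \<in> borel_measurable (borel \<Otimes>\<^sub>M M)"
    and x [measurable]: "x \<in> borel_measurable M"
    and diff: "\<And>p. p \<in> space M \<Longrightarrow> (\<lambda>u. h u p) differentiable (at (x p))"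
  shows "(\<lambda>p. gradient (\<lambda>u. h u p) (x p)) \<in> borel_measurable M"
proof -
  have hm [measurable]: "(\<lambda>p. h (w p) p) \<in> borel_measurable M" if [measurable]: "w \<in> borel_measurable M" for w
    using measurable_compose[OF _ h, of "\<lambda>p. (w p, p)" M] by simp
  have "(\<lambda>p. inner (gradient (\<lambda>u. h u p) (x p)) b) \<in> borel_measurable M" for b
    by (rule borel_measurable_LIMSEQ_real[OF inner_gradient_LIMSEQ[OF diff]]) measurable
  then show ?thesis by (subst borel_measurable_euclidean_space) blast
qed

text \<open>Differentiability in each block does not give joint continuity in \<open>(u, v)\<close>.
  The Caratheodory argument is therefore applied twice: in \<open>u\<close> for fixed
  \<open>v\<close>, then in \<open>v\<close> with \<open>(u, s)\<close> as the parameter.\<close>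

lemma borel_measurable_saddle_grad:
  fixes f :: "'a::euclidean_space \<Rightarrow> 'b::euclidean_space \<Rightarrow> 's \<Rightarrow> real"
  assumes meas: "\<And>u v. f u v \<in> borel_measurable D"
    and diff: "\<And>s. s \<in> space D \<Longrightarrow> partially_differentiable (\<lambda>u v. f u v s)"
  shows "(\<lambda>(x, s). saddle_grad (\<lambda>u v. f u v s) x) \<in> borel_measurable (borel \<Otimes>\<^sub>M D)"
proof -
  have du: "(\<lambda>u. f u v s) differentiable (at u)" and dv: "(\<lambda>v. f u v s) differentiable (at v)"
    if "s \<in> space D" for u v s
    using diff[OF that] by (auto simp: partially_differentiable_def)
  have cu: "continuous_on UNIV (\<lambda>u. f u v s)" if "s \<in> space D" for v s
    using du[OF that] by (auto simp: continuous_on_eq_continuous_at intro: differentiable_imp_continuous_within)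
  have fu: "(\<lambda>(u, s). f u v s) \<in> borel_measurable (borel \<Otimes>\<^sub>M D)" for v
    using meas cu by (rule caratheodory_measurable)
  moreover have "continuous_on UNIV (\<lambda>v. case p of (u, s) \<Rightarrow> f u v s)" if "p \<in> space (borel \<Otimes>\<^sub>M D)" for p
    using dv that by (auto simp: space_pair_measure continuous_on_eq_continuous_at intro: differentiable_imp_continuous_within)
  ultimately have fvm: "(\<lambda>(v, p). case p of (u, s) \<Rightarrow> f u v s) \<in> borel_measurable (borel \<Otimes>\<^sub>M (borel \<Otimes>\<^sub>M D))"
    by (intro caratheodory_measurable[of "\<lambda>v p. case p of (u, s) \<Rightarrow> f u v s"] fu)
  have f: "(\<lambda>p. f (w p) (w' p) (r p)) \<in> borel_measurable N"
    if [measurable]: "w \<in> borel_measurable N" "w' \<in> borel_measurable N" "r \<in> N \<rightarrow>\<^sub>M D" for w w' r and N :: "'n measure"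
  proof -
    have "(\<lambda>p. (w' p, w p, r p)) \<in> N \<rightarrow>\<^sub>M borel \<Otimes>\<^sub>M (borel \<Otimes>\<^sub>M D)" by measurable
    from measurable_compose[OF this fvm] show ?thesis by simp
  qed
  have sp: "snd p \<in> space D" if "p \<in> space (borel \<Otimes>\<^sub>M D)" for p :: "('a \<times> 'b) \<times> 's"
    using that by (auto simp: space_pair_measure)
  have [measurable]: "(fst :: 'a \<times> 'b \<Rightarrow> 'a) \<in> borel_measurable borel" "(snd :: 'a \<times> 'b \<Rightarrow> 'b) \<in> borel_measurable borel"
    unfolding borel_prod[symmetric] by measurable
  have "(\<lambda>p. gradient (\<lambda>u. f u (snd (fst p)) (snd p)) (fst (fst p))) \<in> borel_measurable ((borel :: ('a \<times> 'b) measure) \<Otimes>\<^sub>M D)"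
  proof (rule borel_measurable_gradient)
    show "(\<lambda>(u, p). f u (snd (fst p)) (snd p)) \<in> borel_measurable (borel \<Otimes>\<^sub>M ((borel :: ('a \<times> 'b) measure) \<Otimes>\<^sub>M D))"
      unfolding split_beta by (rule f) measurable
  qed (auto intro!: du sp)
  moreover have "(\<lambda>p. gradient (\<lambda>v. f (fst (fst p)) v (snd p)) (snd (fst p))) \<in> borel_measurable ((borel :: ('a \<times> 'b) measure) \<Otimes>\<^sub>M D)"
  proof (rule borel_measurable_gradient)
    show "(\<lambda>(v, p). f (fst (fst p)) v (snd p)) \<in> borel_measurable (borel \<Otimes>\<^sub>M ((borel :: ('a \<times> 'b) measure) \<Otimes>\<^sub>M D))"
      unfolding split_beta by (rule f) measurable
  qed (auto intro!: dv sp)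
  ultimately show ?thesis
    unfolding saddle_grad_def split_beta by (intro borel_measurable_Pair borel_measurable_uminus)
qed

subsection \<open>Noise given the past\<close>

definition square_integrable :: "'w measure \<Rightarrow> ('w \<Rightarrow> 'c::euclidean_space) \<Rightarrow> bool" where
  "square_integrable P Y \<longleftrightarrow> Y \<in> borel_measurable P \<and> integrable P (\<lambda>\<omega>. (norm (Y \<omega>))\<^sup>2)"

lemma square_integrableD:
  assumes "square_integrable P Y"
  shows "Y \<in> borel_measurable P" and "integrable P (\<lambda>\<omega>. (norm (Y \<omega>))\<^sup>2)"
  using assms by (auto simp: square_integrable_def)

lemma norm_add_power2_le: "(norm (x + y))\<^sup>2 \<le> 2 * (norm x)\<^sup>2 + 2 * (norm (y :: 'c::real_inner))\<^sup>2"
proof -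
  have "(norm (x + y))\<^sup>2 + (norm (x - y))\<^sup>2 = 2 * (norm x)\<^sup>2 + 2 * (norm y)\<^sup>2"
    by (simp add: power2_norm_eq_inner inner_add inner_diff inner_commute)
  then show ?thesis by (smt (verit) zero_le_power2)
qed

lemma square_integrable_add:
  assumes "square_integrable P X" "square_integrable P Y"
  shows "square_integrable P (\<lambda>\<omega>. X \<omega> + Y \<omega>)"
proof -
  note [measurable] = square_integrableD(1)[OF assms(1)] square_integrableD(1)[OF assms(2)]
  have "integrable P (\<lambda>\<omega>. 2 * (norm (X \<omega>))\<^sup>2 + 2 * (norm (Y \<omega>))\<^sup>2)"
    using square_integrableD(2)[OF assms(1)] square_integrableD(2)[OF assms(2)] by simp
  then have "integrable P (\<lambda>\<omega>. (norm (X \<omega> + Y \<omega>))\<^sup>2)"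
    by (rule Bochner_Integration.integrable_bound) (auto intro!: AE_I2 order_trans[OF norm_add_power2_le])
  then show ?thesis by (simp add: square_integrable_def)
qed

lemma square_integrable_scaleR:
  assumes "square_integrable P X"
  shows "square_integrable P (\<lambda>\<omega>. c *\<^sub>R X \<omega>)"
  using square_integrableD[OF assms] by (simp add: square_integrable_def power_mult_distrib)

lemma square_integrable_diff:
  assumes "square_integrable P X" "square_integrable P Y"
  shows "square_integrable P (\<lambda>\<omega>. X \<omega> - Y \<omega>)"
  using square_integrable_add[OF assms(1) square_integrable_scaleR[OF assms(2), of "-1"]] by simp

lemma square_integrable_sum:
  assumes "\<And>i. i \<in> I \<Longrightarrow> square_integrable P (X i)"
  shows "square_integrable P (\<lambda>\<omega>. \<Sum>i\<in>I. X i \<omega>)"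
  using assms
proof (induction I rule: infinite_finite_induct)
  case (insert i I)
  then show ?case by (simp add: square_integrable_add)
qed (simp_all add: square_integrable_def)

lemma square_integrable_inner:
  assumes "square_integrable P X" "square_integrable P Y"
  shows "integrable P (\<lambda>\<omega>. inner (X \<omega>) (Y \<omega>))"
proof -
  have "integrable P (\<lambda>\<omega>. (norm (X \<omega> + Y \<omega>))\<^sup>2 - (norm (X \<omega>))\<^sup>2 - (norm (Y \<omega>))\<^sup>2)"
    using square_integrableD(2)[OF assms(1)] square_integrableD(2)[OF assms(2)]
      square_integrableD(2)[OF square_integrable_add[OF assms]] by simp
  then have "integrable P (\<lambda>\<omega>. (1/2) * ((norm (X \<omega> + Y \<omega>))\<^sup>2 - (norm (X \<omega>))\<^sup>2 - (norm (Y \<omega>))\<^sup>2))"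
    by (rule integrable_mult_right)
  moreover have "(1/2) * ((norm (x + y))\<^sup>2 - (norm x)\<^sup>2 - (norm y)\<^sup>2) = inner x y" for x y :: 'b
    by (simp add: power2_norm_eq_inner inner_add inner_commute)
  ultimately show ?thesis by simp
qed

lemma (in finite_measure) square_integrable_bounded:
  assumes "Y \<in> borel_measurable M" and "\<And>\<omega>. norm (Y \<omega>) \<le> B"
  shows "square_integrable M Y"
proof -
  have "integrable M (\<lambda>\<omega>. (norm (Y \<omega>))\<^sup>2)"
    using assms by (intro integrable_const_bound[where B = "B\<^sup>2"]) (auto intro!: AE_I2 power_mono)
  then show ?thesis using assms(1) by (simp add: square_integrable_def)
qed

text \<open>Here \<open>N\<close> plays the role of the information available before the sample \<open>X\<close> is drawn.\<close>

lemma (in prob_space) noise_given_past: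
  fixes gs :: "'c::euclidean_space \<Rightarrow> 's \<Rightarrow> 'c" and X :: "'a \<Rightarrow> 's"
  assumes idm [measurable]: "(\<lambda>\<omega>. \<omega>) \<in> M \<rightarrow>\<^sub>M N" and X [measurable]: "X \<in> M \<rightarrow>\<^sub>M D"
    and ind: "distr M N (\<lambda>\<omega>. \<omega>) \<Otimes>\<^sub>M distr M D X = distr M (N \<Otimes>\<^sub>M D) (\<lambda>\<omega>. (\<omega>, X \<omega>))"
    and D: "prob_space D" "distr M D X = D"
    and gs: "(\<lambda>(x, s). gs x s) \<in> borel_measurable (borel \<Otimes>\<^sub>M D)"
    and g [measurable]: "g \<in> borel_measurable borel"
    and mean: "\<And>x. integrable D (gs x)" "\<And>x. (\<integral>s. gs x s \<partial>D) = g x"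
    and var: "\<And>x. integrable D (\<lambda>s. (norm (gs x s - g x))\<^sup>2)"
      "\<And>x. (\<integral>s. (norm (gs x s - g x))\<^sup>2 \<partial>D) \<le> V"
    and z [measurable]: "z \<in> borel_measurable N"
  shows "square_integrable M (\<lambda>\<omega>. gs (z \<omega>) (X \<omega>) - g (z \<omega>))"
    and "expectation (\<lambda>\<omega>. (norm (gs (z \<omega>) (X \<omega>) - g (z \<omega>)))\<^sup>2) \<le> V"
    and "\<And>Y. Y \<in> borel_measurable N \<Longrightarrow> square_integrable M Y \<Longrightarrow>
      expectation (\<lambda>\<omega>. inner (gs (z \<omega>) (X \<omega>) - g (z \<omega>)) (Y \<omega>)) = 0"
proof -
  interpret D: prob_space D by fact
  \<comment> \<open>\<open>Q\<close> is the restriction of \<open>M\<close> to the events of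
    \<open>N\<close>. Independence turns the law of the pair into the product of \<open>Q\<close>
    and \<open>D\<close>, so the sample can be integrated first, with \<open>\<omega>\<close>
    frozen.\<close>
  define Q where "Q = distr M N (\<lambda>\<omega>. \<omega>)"
  interpret Q: prob_space Q unfolding Q_def by (rule prob_space_distr) fact
  interpret QD: pair_prob_space Q D ..
  have setsQ [measurable_cong]: "sets Q = sets N" by (simp add: Q_def)
  have joint: "distr M (N \<Otimes>\<^sub>M D) (\<lambda>\<omega>. (\<omega>, X \<omega>)) = Q \<Otimes>\<^sub>M D"
    using ind D(2) unfolding Q_def by simp
  have pair: "(\<lambda>\<omega>. (\<omega>, X \<omega>)) \<in> M \<rightarrow>\<^sub>M N \<Otimes>\<^sub>M D" by measurable
  have e [measurable]: "(\<lambda>p. gs (z (fst p)) (snd p) - g (z (fst p))) \<in> borel_measurable (N \<Otimes>\<^sub>M D)"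
    using measurable_compose[OF _ gs, of "\<lambda>p. (z (fst p), snd p)" "N \<Otimes>\<^sub>M D"] by simp
  have em: "(\<lambda>\<omega>. gs (z \<omega>) (X \<omega>) - g (z \<omega>)) \<in> borel_measurable M"
    using measurable_compose[OF pair e] by simp
  have V: "V \<ge> 0" using var(2)[of 0] by (meson Bochner_Integration.integral_nonneg order_trans zero_le_power2)
  \<comment> \<open>Integrability is not known yet, so the variance is computed with the nonnegative
    integral, which yields integrability and the bound together.\<close>
  have "(\<integral>\<^sup>+\<omega>. ennreal ((norm (gs (z \<omega>) (X \<omega>) - g (z \<omega>)))\<^sup>2) \<partial>M)
    = (\<integral>\<^sup>+p. ennreal ((norm (gs (z (fst p)) (snd p) - g (z (fst p))))\<^sup>2) \<partial>(Q \<Otimes>\<^sub>M D))"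
    unfolding joint[symmetric] by (subst nn_integral_distr[OF pair]) simp_all
  also have "\<dots> = (\<integral>\<^sup>+\<omega>. (\<integral>\<^sup>+s. ennreal ((norm (gs (z \<omega>) s - g (z \<omega>)))\<^sup>2) \<partial>D) \<partial>Q)"
    by (subst D.nn_integral_fst[symmetric]) simp_all
  also have "\<dots> = (\<integral>\<^sup>+\<omega>. ennreal (\<integral>s. (norm (gs (z \<omega>) s - g (z \<omega>)))\<^sup>2 \<partial>D) \<partial>Q)"
    using var(1) by (intro nn_integral_cong nn_integral_eq_integral) auto
  also have "\<dots> \<le> (\<integral>\<^sup>+\<omega>. ennreal V \<partial>Q)"
    using var(2) by (intro nn_integral_mono ennreal_leI)
  also have "\<dots> = ennreal V" by (simp add: Q.emeasure_space_1)
  finally have nn: "(\<integral>\<^sup>+\<omega>. ennreal ((norm (gs (z \<omega>) (X \<omega>) - g (z \<omega>)))\<^sup>2) \<partial>M) \<le> ennreal V" .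
  have int: "integrable M (\<lambda>\<omega>. (norm (gs (z \<omega>) (X \<omega>) - g (z \<omega>)))\<^sup>2)"
    using em nn by (intro integrableI_nonneg) (auto simp: le_less_trans[OF _ ennreal_less_top])
  then show sq: "square_integrable M (\<lambda>\<omega>. gs (z \<omega>) (X \<omega>) - g (z \<omega>))"
    using em by (simp add: square_integrable_def)
  show "expectation (\<lambda>\<omega>. (norm (gs (z \<omega>) (X \<omega>) - g (z \<omega>)))\<^sup>2) \<le> V"
    using nn V nn_integral_eq_integral[OF int] by simp
  fix Y :: "'a \<Rightarrow> 'c" assume Y [measurable]: "Y \<in> borel_measurable N" and Yint: "square_integrable M Y"
  let ?k = "\<lambda>p. inner (gs (z (fst p)) (snd p) - g (z (fst p))) (Y (fst p))"
  have k: "?k \<in> borel_measurable (N \<Otimes>\<^sub>M D)" by measurable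
  have "integrable M (\<lambda>\<omega>. inner (gs (z \<omega>) (X \<omega>) - g (z \<omega>)) (Y \<omega>))"
    using sq Yint by (rule square_integrable_inner)
  then have "integrable (Q \<Otimes>\<^sub>M D) ?k"
    unfolding joint[symmetric] by (subst integrable_distr_eq[OF pair k]) simp
  then have "(\<integral>\<omega>. (\<integral>s. ?k (\<omega>, s) \<partial>D) \<partial>Q) = (\<integral>p. ?k p \<partial>(Q \<Otimes>\<^sub>M D))"
    by (rule QD.integral_fst')
  also have "\<dots> = expectation (\<lambda>\<omega>. inner (gs (z \<omega>) (X \<omega>) - g (z \<omega>)) (Y \<omega>))"
    unfolding joint[symmetric] by (subst integral_distr[OF pair k]) simp
  finally show "expectation (\<lambda>\<omega>. inner (gs (z \<omega>) (X \<omega>) - g (z \<omega>)) (Y \<omega>)) = 0"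
    using mean by (simp add: D.prob_space)
qed

text \<open>The sub-sigma-algebra generated by the samples with index in \<open>J\<close>;
  measurability from it expresses dependence on these samples alone.\<close>

definition past :: "'w measure \<Rightarrow> 's measure \<Rightarrow> ('i \<Rightarrow> 'w \<Rightarrow> 's) \<Rightarrow> 'i set \<Rightarrow> 'w measure" where
  "past P D X J = vimage_algebra (space P) (\<lambda>\<omega>. \<lambda>a\<in>J. X a \<omega>) (\<Pi>\<^sub>M a\<in>J. D)"

lemma measurable_past:
  assumes X: "\<And>a. a \<in> J \<Longrightarrow> X a \<in> P \<rightarrow>\<^sub>M D"
  shows "(\<lambda>\<omega>. \<omega>) \<in> P \<rightarrow>\<^sub>M past P D X J" and "a \<in> J \<Longrightarrow> X a \<in> past P D X J \<rightarrow>\<^sub>M D"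
proof -
  have XJ: "(\<lambda>\<omega>. \<lambda>a\<in>J. X a \<omega>) \<in> P \<rightarrow>\<^sub>M (\<Pi>\<^sub>M a\<in>J. D)"
    using X by (rule measurable_restrict)
  then show "(\<lambda>\<omega>. \<omega>) \<in> P \<rightarrow>\<^sub>M past P D X J"
    unfolding past_def by (intro measurable_vimage_algebra2) auto
  assume a: "a \<in> J"
  have "(\<lambda>\<omega>. \<lambda>a\<in>J. X a \<omega>) \<in> past P D X J \<rightarrow>\<^sub>M (\<Pi>\<^sub>M a\<in>J. D)"
    unfolding past_def using measurable_space[OF XJ] by (intro measurable_vimage_algebra1) auto
  from measurable_compose[OF this measurable_component_singleton[OF a]]
  show "X a \<in> past P D X J \<rightarrow>\<^sub>M D" using a by simp
qed

text \<open>A product measure is determined by rectangles. Since events of the past are preimages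
  under the family over \<open>J\<close>, on a rectangle the claim is the independence of that
  family from sample \<open>a\<close>.\<close>

lemma (in prob_space) joint_distr_past:
  assumes ind: "indep_vars (\<lambda>_. D) X I" and J: "J \<subseteq> I" and a: "a \<in> I" "a \<notin> J"
  shows "distr M (past M D X J) (\<lambda>\<omega>. \<omega>) \<Otimes>\<^sub>M distr M D (X a)
    = distr M (past M D X J \<Otimes>\<^sub>M D) (\<lambda>\<omega>. (\<omega>, X a \<omega>))"
proof (rule pair_measure_eqI)
  have X: "X i \<in> M \<rightarrow>\<^sub>M D" if "i \<in> I" for i
    using ind that by (auto simp: indep_vars_def)
  let ?XJ = "\<lambda>\<omega>. \<lambda>a\<in>J. X a \<omega>"
  have i: "indep_var (\<Pi>\<^sub>M a\<in>J. D) ?XJ (\<Pi>\<^sub>M a\<in>{a}. D) (\<lambda>\<omega>. \<lambda>b\<in>{a}. X b \<omega>)"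
    using J a by (intro indep_var_restrict[OF ind]) auto
  have XJ: "?XJ \<in> M \<rightarrow>\<^sub>M (\<Pi>\<^sub>M a\<in>J. D)" using i by (rule indep_var_rv1)
  have sets_past: "sets (past M D X J) = {?XJ -` A \<inter> space M | A. A \<in> sets (\<Pi>\<^sub>M a\<in>J. D)}"
    unfolding past_def using measurable_space[OF XJ] by (intro sets_vimage_algebra2) auto
  have idm: "(\<lambda>\<omega>. \<omega>) \<in> M \<rightarrow>\<^sub>M past M D X J" using X J by (intro measurable_past) auto
  have Xa: "X a \<in> M \<rightarrow>\<^sub>M D" using X a by blast
  have pair: "(\<lambda>\<omega>. (\<omega>, X a \<omega>)) \<in> M \<rightarrow>\<^sub>M past M D X J \<Otimes>\<^sub>M D"
    using idm Xa by (rule measurable_Pair)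
  show "sigma_finite_measure (distr M (past M D X J) (\<lambda>\<omega>. \<omega>))"
    by (intro prob_space_imp_sigma_finite prob_space_distr idm)
  show "sigma_finite_measure (distr M D (X a))"
    by (intro prob_space_imp_sigma_finite prob_space_distr Xa)
  show "sets (distr M (past M D X J) (\<lambda>\<omega>. \<omega>) \<Otimes>\<^sub>M distr M D (X a))
    = sets (distr M (past M D X J \<Otimes>\<^sub>M D) (\<lambda>\<omega>. (\<omega>, X a \<omega>)))"
    by (simp cong: sets_pair_measure_cong)
  fix A B
  assume "A \<in> sets (distr M (past M D X J) (\<lambda>\<omega>. \<omega>))" "B \<in> sets (distr M D (X a))"
  then have A: "A \<in> sets (past M D X J)" and B: "B \<in> sets D" by auto
  obtain A' where A': "A' \<in> sets (\<Pi>\<^sub>M a\<in>J. D)" "A = ?XJ -` A' \<inter> space M"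
    using A unfolding sets_past by blast
  \<comment> \<open>Independence is available for restricted families, so the event for
    \<open>X a\<close> is lifted to the one-element family over \<open>{a}\<close>.\<close>
  define B' where "B' = (\<lambda>f. f a) -` B \<inter> space (\<Pi>\<^sub>M a\<in>{a}. D)"
  have B': "B' \<in> sets (\<Pi>\<^sub>M a\<in>{a}. D)"
  proof -
    have "(\<lambda>f. f a) \<in> (\<Pi>\<^sub>M a\<in>{a}. D) \<rightarrow>\<^sub>M D" by (rule measurable_component_singleton) simp
    from measurable_sets[OF this B] show ?thesis by (simp add: B'_def)
  qed
  have Bpre: "(\<lambda>\<omega>. \<lambda>b\<in>{a}. X b \<omega>) -` B' \<inter> space M = X a -` B \<inter> space M"
    using measurable_space[OF Xa] by (auto simp: B'_def space_PiM)
  have "(\<lambda>\<omega>. (?XJ \<omega>, \<lambda>b\<in>{a}. X b \<omega>)) -` (A' \<times> B') \<inter> space M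
    = (?XJ -` A' \<inter> space M) \<inter> ((\<lambda>\<omega>. \<lambda>b\<in>{a}. X b \<omega>) -` B' \<inter> space M)"
    by blast
  also have "\<dots> = (\<lambda>\<omega>. (\<omega>, X a \<omega>)) -` (A \<times> B) \<inter> space M"
    unfolding Bpre A'(2) by blast
  finally have "prob ((\<lambda>\<omega>. (\<omega>, X a \<omega>)) -` (A \<times> B) \<inter> space M) = prob A * prob (X a -` B \<inter> space M)"
    using indep_varD[OF i A'(1) B'] unfolding Bpre A'(2) by simp
  moreover have "(\<lambda>\<omega>. \<omega>) -` A \<inter> space M = A" using A'(2) by auto
  ultimately show "emeasure (distr M (past M D X J) (\<lambda>\<omega>. \<omega>)) A * emeasure (distr M D (X a)) B
    = emeasure (distr M (past M D X J \<Otimes>\<^sub>M D) (\<lambda>\<omega>. (\<omega>, X a \<omega>))) (A \<times> B)"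
    using A B by (simp add: emeasure_distr idm Xa pair emeasure_eq_measure ennreal_mult)
qed

text \<open>Pythagoras: expanding the square leaves only the diagonal terms.\<close>

lemma (in prob_space) expectation_norm_sum_orthogonal:
  fixes e :: "'i \<Rightarrow> 'a \<Rightarrow> 'c::euclidean_space"
  assumes A: "finite A" and sq: "\<And>p. p \<in> A \<Longrightarrow> square_integrable M (e p)"
    and V: "\<And>p. p \<in> A \<Longrightarrow> expectation (\<lambda>\<omega>. (norm (e p \<omega>))\<^sup>2) \<le> V"
    and orth: "\<And>p q. p \<in> A \<Longrightarrow> q \<in> A \<Longrightarrow> p \<noteq> q \<Longrightarrow> expectation (\<lambda>\<omega>. inner (e p \<omega>) (e q \<omega>)) = 0"
  shows "expectation (\<lambda>\<omega>. (norm (\<Sum>p\<in>A. e p \<omega>))\<^sup>2) \<le> real (card A) * V"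
proof -
  have "expectation (\<lambda>\<omega>. (norm (\<Sum>p\<in>A. e p \<omega>))\<^sup>2) = expectation (\<lambda>\<omega>. \<Sum>p\<in>A. \<Sum>q\<in>A. inner (e q \<omega>) (e p \<omega>))"
    unfolding power2_norm_eq_inner inner_sum_left inner_sum_right ..
  also have "\<dots> = (\<Sum>p\<in>A. \<Sum>q\<in>A. expectation (\<lambda>\<omega>. inner (e q \<omega>) (e p \<omega>)))"
    using sq by (subst Bochner_Integration.integral_sum)
      (auto intro!: sum.cong Bochner_Integration.integral_sum Bochner_Integration.integrable_sum square_integrable_inner)
  also have "\<dots> = (\<Sum>p\<in>A. \<Sum>q\<in>A. if q = p then expectation (\<lambda>\<omega>. (norm (e p \<omega>))\<^sup>2) else 0)"
    using orth by (intro sum.cong refl) (auto simp: power2_norm_eq_inner)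
  also have "\<dots> \<le> real (card A) * V" using A V by (simp add: sum_bounded_above)
  finally show ?thesis .
qed

subsection \<open>DPOSG\<close>

definition dispersion :: "nat \<Rightarrow> (nat \<Rightarrow> 'c::real_inner) \<Rightarrow> real" where
  "dispersion M X = (1 / real M) * (\<Sum>i<M. (norm (X i - column_avg M X))\<^sup>2)"

lemma sum_diff_column_avg:
  assumes "M \<ge> 1"
  shows "(\<Sum>i<M. X i - column_avg M X) = 0"
  using assms by (simp add: sum_subtractf column_avg_def sum_constant_scaleR)

lemma column_avg_mix_step:
  fixes X :: "nat \<Rightarrow> 'c::euclidean_space"
  assumes W: "sym_doubly_stochastic M W"
  shows "column_avg M (\<lambda>i. mix M (W ^\<^sub>m t) X i - \<eta> *\<^sub>R Y i) = column_avg M X - \<eta> *\<^sub>R column_avg M Y"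
  by (simp add: column_avg_def sum_subtractf sum_mix_pow[OF W] scaleR_diff_right scaleR_sum_right
      scaleR_left_commute flip: scaleR_sum_right)

lemma norm_diff_power2_le: "(norm (x - y))\<^sup>2 \<le> 2 * (norm x)\<^sup>2 + 2 * (norm (y :: 'c::real_inner))\<^sup>2"
  using norm_add_power2_le[of x "- y"] by simp

text \<open>Jensen's inequality for uniform weights; with three or five columns it also yields the
  bounds for short sums below.\<close>

lemma norm_column_avg_power2_le:
  fixes X :: "nat \<Rightarrow> 'c::real_inner"
  shows "(norm (column_avg M X))\<^sup>2 \<le> (1 / real M) * (\<Sum>i<M. (norm (X i))\<^sup>2)"
proof (cases "M = 0")
  case False
  then have M: "real M > 0" by simp
  have "(norm (\<Sum>i<M. X i))\<^sup>2 \<le> (\<Sum>i<M. norm (X i))\<^sup>2"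
    by (intro power_mono norm_sum) simp
  also have "\<dots> \<le> real M * (\<Sum>i<M. (norm (X i))\<^sup>2)"
    using sum_squared_le_sum_of_squares[of "\<lambda>i. norm (X i)" "{..<M}"] by (simp add: mult.commute)
  finally have "(1 / real M)\<^sup>2 * (norm (\<Sum>i<M. X i))\<^sup>2 \<le> (1 / real M)\<^sup>2 * (real M * (\<Sum>i<M. (norm (X i))\<^sup>2))"
    by (intro mult_left_mono) auto
  then have "(norm (column_avg M X))\<^sup>2 \<le> (1 / real M)\<^sup>2 * (real M * (\<Sum>i<M. (norm (X i))\<^sup>2))"
    by (simp add: column_avg_def power_divide)
  also have "\<dots> = (1 / real M) * (\<Sum>i<M. (norm (X i))\<^sup>2)" using M by (simp add: power2_eq_square)
  finally show ?thesis .
qed (simp add: column_avg_def)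

text \<open>Deviations from the average sum to zero, so the cross term drops and any other centre
  \<open>c\<close> only adds a square. A convenient centre may thus replace the average.\<close>

lemma dispersion_le:
  fixes X :: "nat \<Rightarrow> 'c::real_inner"
  assumes "M \<ge> 1"
  shows "dispersion M X \<le> (1 / real M) * (\<Sum>i<M. (norm (X i - c))\<^sup>2)"
proof -
  let ?a = "column_avg M X"
  have *: "(norm (X i - c))\<^sup>2 = (norm (X i - ?a))\<^sup>2 + 2 * inner (X i - ?a) (?a - c) + (norm (?a - c))\<^sup>2" for i
    by (simp add: power2_norm_eq_inner inner_diff_left inner_diff_right inner_commute algebra_simps)
  have "(\<Sum>i<M. (norm (X i - c))\<^sup>2) = (\<Sum>i<M. (norm (X i - ?a))\<^sup>2) + 2 * inner (\<Sum>i<M. X i - ?a) (?a - c)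
    + real M * (norm (?a - c))\<^sup>2"
    unfolding * by (simp add: sum.distrib inner_sum_left sum_distrib_left)
  then have "(\<Sum>i<M. (norm (X i - ?a))\<^sup>2) \<le> (\<Sum>i<M. (norm (X i - c))\<^sup>2)"
    unfolding sum_diff_column_avg[OF assms] by simp
  then show ?thesis unfolding dispersion_def by (intro mult_left_mono) auto
qed

text \<open>Mixing fixes constant columns, so the average can be subtracted before mixing, where the
  contraction for sum zero applies. Splitting off \<open>Y\<close> costs the factor 2, so the
  recursion is useful only if \<open>(mixing_rate W ^ t)\<^sup>2\<close> is below 1/2.\<close>

lemma dispersion_mix_step_le:
  fixes X :: "nat \<Rightarrow> 'c::euclidean_space"
  assumes W: "sym_doubly_stochastic M W" and M: "M \<ge> 2" and rho: "mixing_rate W < 1"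
  shows "dispersion M (\<lambda>i. mix M (W ^\<^sub>m t) X i - \<eta> *\<^sub>R Y i)
    \<le> 2 * (mixing_rate W ^ t)\<^sup>2 * dispersion M X + 2 * \<eta>\<^sup>2 * dispersion M Y"
proof -
  let ?A = "W ^\<^sub>m t" and ?a = "column_avg M X" and ?b = "column_avg M Y"
  have const: "mix M ?A (\<lambda>_. c) i = c" if "i < M" for i and c :: 'c
    using that
  proof (induction t arbitrary: i)
    case 0
    then show ?case by (rule mix_pow_0[OF sym_doubly_stochasticD(2)[OF W]])
  next
    case (Suc t)
    have "mix M (W ^\<^sub>m Suc t) (\<lambda>_. c) i = mix M W (mix M (W ^\<^sub>m t) (\<lambda>_. c)) i"
      by (rule mix_pow_Suc[OF sym_doubly_stochasticD(2)[OF W] Suc.prems])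
    also have "\<dots> = mix M W (\<lambda>_. c) i" by (rule mix_cong) (rule Suc.IH)
    also have "\<dots> = c"
    proof -
      have "(\<Sum>j<M. W $$ (j, i)) = (\<Sum>j<M. W $$ (i, j))"
        using sym_doubly_stochasticD(1)[OF W] Suc.prems by (intro sum.cong) (auto simp: symmetric_on_def)
      then have "(\<Sum>j<M. W $$ (j, i)) = 1" using W Suc.prems by (simp add: sym_doubly_stochastic_def)
      then show ?thesis by (simp add: mix_def flip: scaleR_sum_left)
    qed
    finally show ?case .
  qed
  have diff: "mix M ?A (\<lambda>i. X i - ?a) i = mix M ?A X i - ?a" if "i < M" for i
    using const[OF that, of ?a] by (simp add: mix_def scaleR_diff_right sum_subtractf)
  have "(\<Sum>i<M. (norm (mix M ?A X i - \<eta> *\<^sub>R Y i - (?a - \<eta> *\<^sub>R ?b)))\<^sup>2)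
    \<le> (\<Sum>i<M. 2 * (norm (mix M ?A X i - ?a))\<^sup>2 + 2 * (norm (\<eta> *\<^sub>R (Y i - ?b)))\<^sup>2)"
  proof (rule sum_mono)
    fix i
    have "mix M ?A X i - \<eta> *\<^sub>R Y i - (?a - \<eta> *\<^sub>R ?b) = (mix M ?A X i - ?a) - \<eta> *\<^sub>R (Y i - ?b)"
      by (simp add: scaleR_diff_right)
    then show "(norm (mix M ?A X i - \<eta> *\<^sub>R Y i - (?a - \<eta> *\<^sub>R ?b)))\<^sup>2
      \<le> 2 * (norm (mix M ?A X i - ?a))\<^sup>2 + 2 * (norm (\<eta> *\<^sub>R (Y i - ?b)))\<^sup>2"
      by (simp only: norm_diff_power2_le)
  qed
  also have "\<dots> = 2 * (\<Sum>i<M. (norm (mix M ?A (\<lambda>i. X i - ?a) i))\<^sup>2) + 2 * \<eta>\<^sup>2 * (\<Sum>i<M. (norm (Y i - ?b))\<^sup>2)"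
    by (simp add: sum.distrib diff power_mult_distrib flip: sum_distrib_left)
  also have "(\<Sum>i<M. (norm (mix M ?A (\<lambda>i. X i - ?a) i))\<^sup>2) \<le> (mixing_rate W ^ t)\<^sup>2 * (\<Sum>i<M. (norm (X i - ?a))\<^sup>2)"
    using M by (intro mix_pow_contraction[OF W M rho] sum_diff_column_avg) simp
  finally have "(\<Sum>i<M. (norm (mix M ?A X i - \<eta> *\<^sub>R Y i - (?a - \<eta> *\<^sub>R ?b)))\<^sup>2)
    \<le> 2 * (mixing_rate W ^ t)\<^sup>2 * (\<Sum>i<M. (norm (X i - ?a))\<^sup>2) + 2 * \<eta>\<^sup>2 * (\<Sum>i<M. (norm (Y i - ?b))\<^sup>2)"
    by simp
  from mult_left_mono[OF this, of "1 / real M"] show ?thesis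
    unfolding dispersion_def column_avg_mix_step[OF W] by (simp add: algebra_simps)
qed

lemma column_avg_lipschitz_error:
  fixes g :: "'c::real_inner \<Rightarrow> 'c"
  assumes lip: "\<And>x y. norm (g x - g y) \<le> L * norm (x - y)" and "M \<ge> 1"
  shows "(norm (column_avg M (\<lambda>i. g (Z i)) - g (column_avg M Z)))\<^sup>2 \<le> L\<^sup>2 * dispersion M Z"
proof -
  let ?z = "column_avg M Z"
  have "column_avg M (\<lambda>i. g (Z i)) - g ?z = column_avg M (\<lambda>i. g (Z i) - g ?z)"
    using assms(2) by (simp add: column_avg_def sum_subtractf scaleR_diff_right sum_constant_scaleR)
  then have "(norm (column_avg M (\<lambda>i. g (Z i)) - g ?z))\<^sup>2 \<le> (1 / real M) * (\<Sum>i<M. (norm (g (Z i) - g ?z))\<^sup>2)"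
    by (simp only: norm_column_avg_power2_le)
  also have "\<dots> \<le> (1 / real M) * (\<Sum>i<M. L\<^sup>2 * (norm (Z i - ?z))\<^sup>2)"
    unfolding power_mult_distrib[symmetric] by (intro mult_left_mono sum_mono power_mono lip) auto
  finally show ?thesis by (simp add: dispersion_def sum_distrib_left mult.left_commute)
qed

text \<open>The Minty condition is applied at the points \<open>Z i\<close> rather than at their average. Since
  the deviations from the average sum to zero, the error is quadratic in them; the obvious
  estimate through \<open>g (column_avg M Z)\<close> only gives a linear error.\<close>

lemma minty_column_avg:
  fixes g :: "'c::real_inner \<Rightarrow> 'c"
  assumes lip: "\<And>x y. norm (g x - g y) \<le> L * norm (x - y)"
    and minty: "\<And>x. inner (g x) (x - xs) \<ge> 0" and "M \<ge> 1"
  shows "inner (column_avg M (\<lambda>i. g (Z i))) (column_avg M Z - xs) \<ge> - L * dispersion M Z"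
proof -
  let ?z = "column_avg M Z"
  \<comment> \<open>The Minty condition lets \<open>?z - xs\<close> be replaced by
    \<open>?z - Z i\<close>; exchanging \<open>g (Z i)\<close> for \<open>g ?z\<close> then costs
    the Lipschitz term, and the remaining linear term cancels in the sum.\<close>
  have split: "inner (g (Z i)) (?z - xs) \<ge> - (L * (norm (Z i - ?z))\<^sup>2) - inner (g ?z) (Z i - ?z)" for i
  proof -
    have "inner (g (Z i) - g ?z) (Z i - ?z) \<le> norm (g (Z i) - g ?z) * norm (Z i - ?z)"
      by (rule norm_cauchy_schwarz)
    also have "\<dots> \<le> L * norm (Z i - ?z) * norm (Z i - ?z)" by (intro mult_right_mono lip) simp
    finally have "inner (g (Z i) - g ?z) (Z i - ?z) \<le> L * (norm (Z i - ?z))\<^sup>2"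
      by (simp add: power2_eq_square mult.assoc)
    then show ?thesis using minty[of "Z i"] by (simp add: inner_diff_left inner_diff_right)
  qed
  have "(\<Sum>i<M. inner (g ?z) (Z i - ?z)) = 0"
    using sum_diff_column_avg[OF assms(3), of Z] by (simp flip: inner_sum_right)
  then have "- L * (\<Sum>i<M. (norm (Z i - ?z))\<^sup>2) = (\<Sum>i<M. - (L * (norm (Z i - ?z))\<^sup>2) - inner (g ?z) (Z i - ?z))"
    by (simp add: sum_subtractf sum_negf sum_distrib_left)
  also have "\<dots> \<le> (\<Sum>i<M. inner (g (Z i)) (?z - xs))" by (intro sum_mono split)
  finally have "(1 / real M) * (- L * (\<Sum>i<M. (norm (Z i - ?z))\<^sup>2)) \<le> (1 / real M) * (\<Sum>i<M. inner (g (Z i)) (?z - xs))"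
    by (intro mult_left_mono) auto
  then show ?thesis by (simp add: dispersion_def column_avg_def inner_sum_left)
qed

text \<open>With z = x - eta u one has <u', x - xs> = <u', z - xs> + eta <u', u>, and completing the
  square in |u'|^2 - 2 <u', u> gives the last two terms. In use \<open>u\<close> and
  \<open>u'\<close> are the averaged gradients of consecutive iterations.\<close>

lemma optimistic_step_energy:
  fixes x :: "'c::real_inner"
  shows "(norm (x - \<eta> *\<^sub>R u' - xs))\<^sup>2 = (norm (x - xs))\<^sup>2 - 2 * \<eta> * inner u' (x - \<eta> *\<^sub>R u - xs)
    + \<eta>\<^sup>2 * (norm (u' - u))\<^sup>2 - \<eta>\<^sup>2 * (norm u)\<^sup>2"
  unfolding power2_norm_eq_inner
  by (simp add: inner_diff_left inner_diff_right inner_commute power2_eq_square algebra_simps)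


lemma norm_sum3_power2_le:
  "(norm (a + b + c :: 'c::real_inner))\<^sup>2 \<le> 3 * ((norm a)\<^sup>2 + (norm b)\<^sup>2 + (norm c)\<^sup>2)"
proof -
  have "(norm (column_avg 3 (\<lambda>i. [a, b, c] ! i)))\<^sup>2 \<le> (1 / 3) * ((norm a)\<^sup>2 + (norm b)\<^sup>2 + (norm c)\<^sup>2)"
    using norm_column_avg_power2_le[of 3 "\<lambda>i. [a, b, c] ! i"] by (simp add: numeral_eq_Suc ac_simps)
  moreover have "column_avg 3 (\<lambda>i. [a, b, c] ! i) = (1 / 3) *\<^sub>R (a + b + c)"
    by (simp add: column_avg_def numeral_eq_Suc ac_simps)
  ultimately show ?thesis by (simp add: power_divide)
qed

lemma norm_sum5_power2_le:
  "(norm (a + b + c + d + e :: 'c::real_inner))\<^sup>2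
    \<le> 5 * ((norm a)\<^sup>2 + (norm b)\<^sup>2 + (norm c)\<^sup>2 + (norm d)\<^sup>2 + (norm e)\<^sup>2)"
proof -
  have "(norm (column_avg 5 (\<lambda>i. [a, b, c, d, e] ! i)))\<^sup>2
      \<le> (1 / 5) * ((norm a)\<^sup>2 + (norm b)\<^sup>2 + (norm c)\<^sup>2 + (norm d)\<^sup>2 + (norm e)\<^sup>2)"
    using norm_column_avg_power2_le[of 5 "\<lambda>i. [a, b, c, d, e] ! i"] by (simp add: numeral_eq_Suc ac_simps)
  moreover have "column_avg 5 (\<lambda>i. [a, b, c, d, e] ! i) = (1 / 5) *\<^sub>R (a + b + c + d + e)"
    by (simp add: column_avg_def numeral_eq_Suc ac_simps)
  ultimately show ?thesis by (simp add: power_divide)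
qed

lemma square_integrable_column_avg:
  assumes "\<And>i. i < M \<Longrightarrow> square_integrable P (X i)"
  shows "square_integrable P (\<lambda>\<omega>. column_avg M (\<lambda>i. X i \<omega>))"
  unfolding column_avg_def using assms by (intro square_integrable_scaleR square_integrable_sum) auto

lemma integrable_dispersion:
  assumes "\<And>i. i < M \<Longrightarrow> square_integrable P (X i)"
  shows "integrable P (\<lambda>\<omega>. dispersion M (\<lambda>i. X i \<omega>))"
  unfolding dispersion_def using assms
  by (intro integrable_mult_right Bochner_Integration.integrable_sum square_integrableD(2)
      square_integrable_diff square_integrable_column_avg) auto

lemma (in finite_measure) square_integrable_const: "square_integrable M (\<lambda>_. c)"
  by (simp add: square_integrable_def)

text \<open>Bookkeeping with \<open>U\<close> the mean square gradients, \<open>V\<close> the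
  drifts, \<open>X\<close> the squared distances and \<open>h\<close> the squared step size. Summing
  the drift bounds and moving 5/36 of the drift to the left leaves 31/36; inserting this into the
  telescoped energy leaves 1 - 5/31 = 26/31 in front of the sum of \<open>U\<close>, whence 31/26
  and 36/26.\<close>

lemma optimistic_sum_bound:
  fixes U V X :: "nat \<Rightarrow> real"
  assumes V: "\<And>k. V k \<ge> 0" and X: "X N \<ge> 0" and h: "h \<ge> 0"
    and energy: "\<And>k. k < N \<Longrightarrow> X (Suc k) \<le> X k + a + h * V k - h * U k"
    and V0: "0 < N \<Longrightarrow> V 0 \<le> B + 5 / 36 * U 0"
    and VS: "\<And>k. Suc k < N \<Longrightarrow> V (Suc k) \<le> B + 5 / 36 * (U (Suc k) + V k)"
  shows "h * (\<Sum>k<N. U k) \<le> 31 / 26 * (X 0 + real N * a) + 36 / 26 * (h * (real N * B))"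
proof -
  have "(\<Sum>k<N. V k) \<le> real N * B + 5 / 36 * ((\<Sum>k<N. U k) + (\<Sum>k<N. V k))"
  proof (cases N)
    case (Suc n)
    have "(\<Sum>k<N. V k) = V 0 + (\<Sum>k<n. V (Suc k))" unfolding Suc by (rule sum.lessThan_Suc_shift)
    also have "\<dots> \<le> (B + 5 / 36 * U 0) + (\<Sum>k<n. B + 5 / 36 * (U (Suc k) + V k))"
      using V0 VS Suc by (intro add_mono sum_mono) auto
    also have "(\<Sum>k<n. B + 5 / 36 * (U (Suc k) + V k)) = real n * B + 5 / 36 * ((\<Sum>k<n. U (Suc k)) + (\<Sum>k<n. V k))"
      by (simp only: sum.distrib sum_distrib_left[symmetric] sum_constant card_lessThan)
    also have "(B + 5 / 36 * U 0) + (real n * B + 5 / 36 * ((\<Sum>k<n. U (Suc k)) + (\<Sum>k<n. V k)))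
        = real N * B + 5 / 36 * ((\<Sum>k<N. U k) + (\<Sum>k<n. V k))"
      unfolding Suc sum.lessThan_Suc_shift[of U] by (simp add: field_simps)
    also have "\<dots> \<le> real N * B + 5 / 36 * ((\<Sum>k<N. U k) + (\<Sum>k<N. V k))"
      using V[of n] by (simp add: Suc)
    finally show ?thesis .
  qed simp
  then have "31 * (\<Sum>k<N. V k) \<le> 36 * (real N * B) + 5 * (\<Sum>k<N. U k)"
    unfolding distrib_left by linarith
  then have "h * (31 * (\<Sum>k<N. V k)) \<le> h * (36 * (real N * B) + 5 * (\<Sum>k<N. U k))"
    by (rule mult_left_mono[OF _ h])
  then have drift: "31 * (h * (\<Sum>k<N. V k)) \<le> 36 * (h * (real N * B)) + 5 * (h * (\<Sum>k<N. U k))"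
    by (simp add: algebra_simps)
  have "X n \<le> X 0 + real n * a + h * (\<Sum>k<n. V k) - h * (\<Sum>k<n. U k)" if "n \<le> N" for n
    using that
  proof (induction n)
    case (Suc n)
    then show ?case using energy[of n] by (simp add: algebra_simps)
  qed simp
  from this[of N] have "h * (\<Sum>k<N. U k) \<le> X 0 + real N * a + h * (\<Sum>k<N. V k)"
    using X by simp
  then show ?thesis using drift unfolding distrib_left by linarith
qed

text \<open>The min-max structure is gone: only an operator and an unbiased, jointly measurable
  oracle for it remain. The number of rounds enters through \<open>contraction\<close>, where 4/9 is
  the square of 2/3, and the step size through \<open>step\<close>.\<close>

locale dposg = prob_space P + D: prob_space D
  for P :: "'w measure" and D :: "'s measure" +
  fixes gs :: "'c::euclidean_space \<Rightarrow> 's \<Rightarrow> 'c" and g :: "'c \<Rightarrow> 'c" and L \<sigma> G \<eta> :: real and xs :: 'c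
    and M m N t :: nat and W :: "real mat" and \<xi> :: "nat \<Rightarrow> nat \<Rightarrow> nat \<Rightarrow> 'w \<Rightarrow> 's"
  assumes gs_meas: "(\<lambda>(x, s). gs x s) \<in> borel_measurable (borel \<Otimes>\<^sub>M D)"
    and L: "L > 0" and lip: "\<And>x y. norm (g x - g y) \<le> L * norm (x - y)"
    and mean: "\<And>x. integrable D (gs x)" "\<And>x. (\<integral>s. gs x s \<partial>D) = g x"
    and var: "\<And>x. integrable D (\<lambda>s. (norm (gs x s - g x))\<^sup>2)"
      "\<And>x. (\<integral>s. (norm (gs x s - g x))\<^sup>2 \<partial>D) \<le> \<sigma>\<^sup>2"
    and bounded: "\<And>x. norm (g x) \<le> G"
    and minty: "\<And>x. inner (g x) (x - xs) \<ge> 0"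
    and M: "M \<ge> 2" and m: "m \<ge> 1"
    and W: "sym_doubly_stochastic M W" and rho: "mixing_rate W < 1"
    and contraction: "(mixing_rate W ^ t)\<^sup>2 \<le> 4 / 9"
    and indep: "indep_vars (\<lambda>_. D) (\<lambda>(k, i, j). \<xi> k i j) ({..N} \<times> {..<M} \<times> {..<m})"
    and distr: "\<And>k i j. k \<le> N \<Longrightarrow> i < M \<Longrightarrow> j < m \<Longrightarrow> distr P D (\<xi> k i j) = D"
    and eta: "\<eta> > 0" and step: "10272 * real M * (\<eta> * L)\<^sup>2 \<le> 1"
begin

section \<open>Iterates, their averages and the sampling noise\<close>

definition "z k i \<omega> = dposg_Z gs M W t m \<eta> (\<lambda>k i j. \<xi> k i j \<omega>) k i"
definition "x k i \<omega> = dposg_X gs M W t m \<eta> (\<lambda>k i j. \<xi> k i j \<omega>) k i"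
definition "sgrad k i \<omega> = minibatch_grad gs m (z k i \<omega>) (\<lambda>j. \<xi> k i j \<omega>)"
definition "noise k i j \<omega> = gs (z k i \<omega>) (\<xi> k i j \<omega>) - g (z k i \<omega>)"
definition "zavg k \<omega> = column_avg M (\<lambda>i. z k i \<omega>)"
definition "xavg k \<omega> = column_avg M (\<lambda>i. x k i \<omega>)"
definition "savg k \<omega> = column_avg M (\<lambda>i. sgrad k i \<omega>)"
definition "gavg k \<omega> = column_avg M (\<lambda>i. g (z k i \<omega>))"

text \<open>Iteration \<open>N\<close> is included because the last energy step, from
  \<open>N - 1\<close> to \<open>N\<close>, uses \<open>savg N\<close>. The set
  \<open>before k\<close> excludes iteration \<open>k\<close>.\<close>

abbreviation "samples \<equiv> {..N} \<times> {..<M} \<times> {..<m}"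
abbreviation "before k \<equiv> {..<k} \<times> {..<M} \<times> {..<m}"
abbreviation "Past J \<equiv> past P D (\<lambda>(k, i, j). \<xi> k i j) J"

lemma iterates_simps:
  "z 0 i \<omega> = 0" "x 0 i \<omega> = 0"
  "z (Suc k) i \<omega> = mix M (W ^\<^sub>m t) (\<lambda>i. x k i \<omega>) i - \<eta> *\<^sub>R sgrad k i \<omega>"
  "x (Suc k) i \<omega> = mix M (W ^\<^sub>m t) (\<lambda>i. x k i \<omega>) i - \<eta> *\<^sub>R sgrad (Suc k) i \<omega>"
  by (simp_all add: z_def x_def sgrad_def)

lemma averages_simps:
  "zavg 0 \<omega> = 0" "xavg 0 \<omega> = 0"
  "zavg (Suc k) \<omega> = xavg k \<omega> - \<eta> *\<^sub>R savg k \<omega>"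
  "xavg (Suc k) \<omega> = xavg k \<omega> - \<eta> *\<^sub>R savg (Suc k) \<omega>"
  by (simp_all only: zavg_def xavg_def savg_def iterates_simps column_avg_mix_step[OF W])
    (simp_all add: column_avg_def)

lemma sgrad_eq: "sgrad k i \<omega> = g (z k i \<omega>) + (1 / real m) *\<^sub>R (\<Sum>j<m. noise k i j \<omega>)"
  using m by (simp add: sgrad_def minibatch_grad_def noise_def sum_subtractf scaleR_diff_right sum_constant_scaleR)

lemma savg_eq:
  "savg k \<omega> - gavg k \<omega> = (1 / (real M * real m)) *\<^sub>R (\<Sum>(i, j)\<in>{..<M} \<times> {..<m}. noise k i j \<omega>)"
  by (simp add: savg_def gavg_def column_avg_def sgrad_eq sum.distrib scaleR_add_right
      sum.cartesian_product[symmetric] flip: scaleR_sum_right)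

lemma g_meas [measurable]: "g \<in> borel_measurable borel"
proof -
  have "L-lipschitz_on UNIV g"
    using lip L by (intro lipschitz_onI) (auto simp: dist_norm)
  then show ?thesis by (intro borel_measurable_continuous_onI lipschitz_on_continuous_on)
qed

lemma sample_meas: "a \<in> samples \<Longrightarrow> (\<lambda>(k, i, j). \<xi> k i j) a \<in> P \<rightarrow>\<^sub>M D"
  using indep unfolding indep_vars_def by blast

text \<open>The flow of information: \<open>z k\<close> sees the samples before iteration
  \<open>k\<close>, whereas \<open>x k\<close> and \<open>sgrad k\<close> also see those of
  \<open>k\<close>. Any larger \<open>J\<close> is allowed, so that all samples but one can serve as
  the past.\<close>

lemma iterates_past:
  assumes "J \<subseteq> samples" and "i < M"
  shows "before k \<subseteq> J \<Longrightarrow> z k i \<in> borel_measurable (Past J)"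
    and "before (Suc k) \<subseteq> J \<Longrightarrow> x k i \<in> borel_measurable (Past J)"
    and "before (Suc k) \<subseteq> J \<Longrightarrow> sgrad k i \<in> borel_measurable (Past J)"
proof -
  have sg: "sgrad k i \<in> borel_measurable (Past J)"
    if "z k i \<in> borel_measurable (Past J)" "before (Suc k) \<subseteq> J" "i < M" for k i
  proof -
    have "(\<lambda>\<omega>. gs (z k i \<omega>) (\<xi> k i j \<omega>)) \<in> borel_measurable (Past J)" if "j < m" for j
    proof -
      have "(k, i, j) \<in> J" using that \<open>before (Suc k) \<subseteq> J\<close> \<open>i < M\<close> by auto
      then have "\<xi> k i j \<in> Past J \<rightarrow>\<^sub>M D"
        using measurable_past(2)[of J "\<lambda>(k, i, j). \<xi> k i j" P D "(k, i, j)"] sample_meas assms(1) by auto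
      with \<open>z k i \<in> _\<close> have "(\<lambda>\<omega>. (z k i \<omega>, \<xi> k i j \<omega>)) \<in> Past J \<rightarrow>\<^sub>M borel \<Otimes>\<^sub>M D"
        by measurable
      from measurable_compose[OF this gs_meas] show ?thesis by simp
    qed
    then show ?thesis unfolding sgrad_def minibatch_grad_def
      by (intro borel_measurable_scaleR borel_measurable_const borel_measurable_sum) auto
  qed
  have "\<forall>i<M. (before k \<subseteq> J \<longrightarrow> z k i \<in> borel_measurable (Past J)) \<and>
      (before (Suc k) \<subseteq> J \<longrightarrow> x k i \<in> borel_measurable (Past J))" for k
  proof (induction k)
    case 0
    then show ?case by (simp add: iterates_simps)
  next
    case (Suc k)
    have mono: "before k \<subseteq> before (Suc k)" for k by auto
    have mixm: "(\<lambda>\<omega>. mix M (W ^\<^sub>m t) (\<lambda>i. x k i \<omega>) i) \<in> borel_measurable (Past J)" if "before (Suc k) \<subseteq> J" for i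
      using Suc that unfolding mix_def
      by (intro borel_measurable_sum borel_measurable_scaleR borel_measurable_const) auto
    have zS: "z (Suc k) i \<in> borel_measurable (Past J)" if "before (Suc k) \<subseteq> J" "i < M" for i
    proof -
      have "sgrad k i \<in> borel_measurable (Past J)" using Suc that mono[of k] by (intro sg) auto
      then show ?thesis using mixm[OF that(1)] unfolding iterates_simps
        by (intro borel_measurable_diff borel_measurable_scaleR borel_measurable_const)
    qed
    moreover have "x (Suc k) i \<in> borel_measurable (Past J)" if "before (Suc (Suc k)) \<subseteq> J" "i < M" for i
    proof -
      have k: "before (Suc k) \<subseteq> J" using that(1) mono[of "Suc k"] by blast
      have "sgrad (Suc k) i \<in> borel_measurable (Past J)" using that by (intro sg zS k) auto
      then show ?thesis using mixm[OF k] unfolding iterates_simps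
        by (intro borel_measurable_diff borel_measurable_scaleR borel_measurable_const)
    qed
    ultimately show ?case by blast
  qed
  then show "before k \<subseteq> J \<Longrightarrow> z k i \<in> borel_measurable (Past J)"
    and "before (Suc k) \<subseteq> J \<Longrightarrow> x k i \<in> borel_measurable (Past J)" using assms(2) by auto
  have "before k \<subseteq> before (Suc k)" by auto
  then show "before (Suc k) \<subseteq> J \<Longrightarrow> sgrad k i \<in> borel_measurable (Past J)"
    using \<open>before k \<subseteq> J \<Longrightarrow> _\<close> assms(2) by (intro sg) auto
qed

text \<open>The past consists of every sample but one, not just of the earlier ones. It determines
  \<open>z k i\<close>, and also the noise of the other samples of the same iteration, so one
  orthogonality statement serves iterates and pairs of noises alike.\<close>

lemma
  assumes "k \<le> N" "i < M" "j < m"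
  shows square_integrable_noise: "square_integrable P (noise k i j)"
    and expectation_noise: "expectation (\<lambda>\<omega>. (norm (noise k i j \<omega>))\<^sup>2) \<le> \<sigma>\<^sup>2"
    and noise_orthogonal: "\<And>Y. Y \<in> borel_measurable (Past (samples - {(k, i, j)})) \<Longrightarrow>
      square_integrable P Y \<Longrightarrow> expectation (\<lambda>\<omega>. inner (noise k i j \<omega>) (Y \<omega>)) = 0"
proof -
  let ?J = "samples - {(k, i, j)}"
  let ?X = "\<lambda>(k, i, j). \<xi> k i j"
  have idm: "(\<lambda>\<omega>. \<omega>) \<in> P \<rightarrow>\<^sub>M Past ?J" using sample_meas by (intro measurable_past) auto
  have X: "\<xi> k i j \<in> P \<rightarrow>\<^sub>M D" using sample_meas[of "(k, i, j)"] assms by simp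
  have joint: "distr P (Past ?J) (\<lambda>\<omega>. \<omega>) \<Otimes>\<^sub>M distr P D (\<xi> k i j)
      = distr P (Past ?J \<Otimes>\<^sub>M D) (\<lambda>\<omega>. (\<omega>, \<xi> k i j \<omega>))"
    using joint_distr_past[OF indep, of ?J "(k, i, j)"] assms by auto
  have z: "z k i \<in> borel_measurable (Past ?J)" using assms by (intro iterates_past) auto
  note n = noise_given_past[OF idm X joint D.prob_space_axioms distr[OF assms] gs_meas g_meas mean var z, folded noise_def]
  show "square_integrable P (noise k i j)" "expectation (\<lambda>\<omega>. (norm (noise k i j \<omega>))\<^sup>2) \<le> \<sigma>\<^sup>2"
    "\<And>Y. Y \<in> borel_measurable (Past (samples - {(k, i, j)})) \<Longrightarrow>
      square_integrable P Y \<Longrightarrow> expectation (\<lambda>\<omega>. inner (noise k i j \<omega>) (Y \<omega>)) = 0"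
    using n unfolding noise_def by auto
qed

lemma from_past:
  assumes "J \<subseteq> samples" and "Y \<in> Past J \<rightarrow>\<^sub>M borel"
  shows "Y \<in> borel_measurable P"
  using measurable_compose[OF measurable_past(1) assms(2)] sample_meas assms(1) by auto

lemma before_subset: "k \<le> Suc N \<Longrightarrow> before k \<subseteq> samples"
  by auto

text \<open>Boundedness of \<open>g\<close> supplies second moments before anything is known about
  those of the iterates.\<close>

lemma square_integrable_g:
  assumes "k \<le> N" "i < M"
  shows "square_integrable P (\<lambda>\<omega>. g (z k i \<omega>))"
proof -
  have k: "before k \<subseteq> samples" using assms by (intro before_subset) simp
  have "z k i \<in> borel_measurable P"
    using from_past[OF k iterates_past(1)[OF k assms(2)]] by simp
  from measurable_compose[OF this g_meas] show ?thesis
    by (rule square_integrable_bounded[OF _ bounded])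
qed

lemma square_integrable_sgrad: "k \<le> N \<Longrightarrow> i < M \<Longrightarrow> square_integrable P (sgrad k i)"
  unfolding sgrad_eq[abs_def]
  by (intro square_integrable_add square_integrable_g square_integrable_scaleR square_integrable_sum
      square_integrable_noise) auto

lemma square_integrable_iterates:
  "k \<le> N \<Longrightarrow> i < M \<Longrightarrow> square_integrable P (z k i)"
  "k \<le> N \<Longrightarrow> i < M \<Longrightarrow> square_integrable P (x k i)"
proof -
  have x: "k \<le> N \<Longrightarrow> i < M \<Longrightarrow> square_integrable P (x k i)" for k i
  proof (induction k arbitrary: i)
    case 0
    then show ?case using square_integrable_const by (simp add: iterates_simps[abs_def])
  next
    case (Suc k)
    then show ?case unfolding iterates_simps(4)[abs_def] mix_def
      by (intro square_integrable_diff square_integrable_scaleR square_integrable_sum square_integrable_sgrad) auto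
  qed
  show "k \<le> N \<Longrightarrow> i < M \<Longrightarrow> square_integrable P (x k i)" by (rule x)
  show "square_integrable P (z k i)" if "k \<le> N" "i < M"
  proof (cases k)
    case 0
    then show ?thesis using square_integrable_const by (simp add: iterates_simps[abs_def])
  next
    case (Suc k')
    then show ?thesis using that x unfolding Suc iterates_simps(3)[abs_def] mix_def
      by (intro square_integrable_diff square_integrable_scaleR square_integrable_sum square_integrable_sgrad) auto
  qed
qed

lemma square_integrable_averages:
  assumes "k \<le> N"
  shows "square_integrable P (zavg k)" "square_integrable P (xavg k)" "square_integrable P (savg k)"
    "square_integrable P (gavg k)"
  unfolding zavg_def[abs_def] xavg_def[abs_def] savg_def[abs_def] gavg_def[abs_def]
  using assms by (intro square_integrable_column_avg square_integrable_iterates square_integrable_sgrad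
      square_integrable_g; simp)+

lemma square_integrable_g_zavg: "k \<le> N \<Longrightarrow> square_integrable P (\<lambda>\<omega>. g (zavg k \<omega>))"
  using measurable_compose[OF square_integrableD(1)[OF square_integrable_averages(1)] g_meas]
  by (intro square_integrable_bounded[OF _ bounded])

lemma noise_past: "k \<le> N \<Longrightarrow> J \<subseteq> samples \<Longrightarrow> before k \<subseteq> J \<Longrightarrow> (k, i, j) \<in> J \<Longrightarrow> noise k i j \<in> borel_measurable (Past J)"
proof -
  assume k: "k \<le> N" "J \<subseteq> samples" "before k \<subseteq> J" "(k, i, j) \<in> J"
  then have z: "z k i \<in> borel_measurable (Past J)" by (intro iterates_past) auto
  have "\<xi> k i j \<in> Past J \<rightarrow>\<^sub>M D"
    using measurable_past(2)[of J "\<lambda>(k, i, j). \<xi> k i j" P D "(k, i, j)"] sample_meas k by auto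
  with z have "(\<lambda>\<omega>. (z k i \<omega>, \<xi> k i j \<omega>)) \<in> Past J \<rightarrow>\<^sub>M borel \<Otimes>\<^sub>M D" by measurable
  from measurable_compose[OF this gs_meas] measurable_compose[OF z g_meas]
  show ?thesis unfolding noise_def[abs_def] by simp
qed

lemma noise_pairwise_orthogonal:
  assumes "k \<le> N" "i < M" "j < m" "i' < M" "j' < m" "(i, j) \<noteq> (i', j')"
  shows "expectation (\<lambda>\<omega>. inner (noise k i j \<omega>) (noise k i' j' \<omega>)) = 0"
  using assms by (intro noise_orthogonal noise_past square_integrable_noise) auto

text \<open>The \<open>M * m\<close> noises of an iteration are pairwise orthogonal, so their
  variances add up before division by the square of \<open>M * m\<close>.\<close>

lemma expectation_savg_noise:
  assumes k: "k \<le> N"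
  shows "expectation (\<lambda>\<omega>. (norm (savg k \<omega> - gavg k \<omega>))\<^sup>2) \<le> \<sigma>\<^sup>2 / (real m * real M)"
proof -
  let ?S = "\<lambda>\<omega>. \<Sum>p\<in>{..<M} \<times> {..<m}. (case p of (i, j) \<Rightarrow> noise k i j) \<omega>"
  have "expectation (\<lambda>\<omega>. (norm (?S \<omega>))\<^sup>2) \<le> real (card ({..<M} \<times> {..<m})) * \<sigma>\<^sup>2"
    using k by (intro expectation_norm_sum_orthogonal)
      (auto intro: square_integrable_noise expectation_noise noise_pairwise_orthogonal)
  then have b: "expectation (\<lambda>\<omega>. (norm (?S \<omega>))\<^sup>2) \<le> real M * real m * \<sigma>\<^sup>2" by (simp add: card_cartesian_product)
  have "(norm (savg k \<omega> - gavg k \<omega>))\<^sup>2 = (1 / (real M * real m))\<^sup>2 * (norm (?S \<omega>))\<^sup>2" for \<omega>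
    unfolding savg_eq by (simp add: power_mult_distrib power_divide case_prod_beta)
  then have "expectation (\<lambda>\<omega>. (norm (savg k \<omega> - gavg k \<omega>))\<^sup>2) = (1 / (real M * real m))\<^sup>2 * expectation (\<lambda>\<omega>. (norm (?S \<omega>))\<^sup>2)"
    by simp
  also have "\<dots> \<le> (1 / (real M * real m))\<^sup>2 * (real M * real m * \<sigma>\<^sup>2)"
    by (intro mult_left_mono b) simp
  also have "\<dots> = \<sigma>\<^sup>2 / (real m * real M)" using M m by (simp add: power2_eq_square field_simps)
  finally show ?thesis .
qed

lemma expectation_sgrad_noise:
  assumes k: "k \<le> N" "i < M"
  shows "expectation (\<lambda>\<omega>. (norm (sgrad k i \<omega> - g (z k i \<omega>)))\<^sup>2) \<le> \<sigma>\<^sup>2 / real m"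
proof -
  let ?S = "\<lambda>\<omega>. \<Sum>j<m. noise k i j \<omega>"
  have "expectation (\<lambda>\<omega>. (norm (?S \<omega>))\<^sup>2) \<le> real (card {..<m}) * \<sigma>\<^sup>2"
    using k by (intro expectation_norm_sum_orthogonal)
      (auto intro: square_integrable_noise expectation_noise noise_pairwise_orthogonal)
  then have b: "expectation (\<lambda>\<omega>. (norm (?S \<omega>))\<^sup>2) \<le> real m * \<sigma>\<^sup>2" by simp
  have "(norm (sgrad k i \<omega> - g (z k i \<omega>)))\<^sup>2 = (1 / real m)\<^sup>2 * (norm (?S \<omega>))\<^sup>2" for \<omega>
    unfolding sgrad_eq by (simp add: power_divide)
  then have "expectation (\<lambda>\<omega>. (norm (sgrad k i \<omega> - g (z k i \<omega>)))\<^sup>2) = (1 / real m)\<^sup>2 * expectation (\<lambda>\<omega>. (norm (?S \<omega>))\<^sup>2)"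
    by simp
  also have "\<dots> \<le> (1 / real m)\<^sup>2 * (real m * \<sigma>\<^sup>2)"
    by (intro mult_left_mono b) simp
  also have "\<dots> = \<sigma>\<^sup>2 / real m" using m by (simp add: power2_eq_square field_simps)
  finally show ?thesis .
qed

text \<open>\<open>zavg k\<close> is built from samples of earlier iterations, hence lies in the
  past of every sample of iteration \<open>k\<close>. This removes the noise term that is linear in
  the energy identity.\<close>

lemma savg_noise_orthogonal:
  assumes k: "k \<le> N"
  shows "expectation (\<lambda>\<omega>. inner (savg k \<omega> - gavg k \<omega>) (zavg k \<omega> - xs)) = 0"
proof -
  have Y: "square_integrable P (\<lambda>\<omega>. zavg k \<omega> - xs)"
    using k by (intro square_integrable_diff square_integrable_averages square_integrable_const)
  have zm: "(\<lambda>\<omega>. zavg k \<omega> - xs) \<in> borel_measurable (Past (samples - {(k, i, j)}))" for i j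
    unfolding zavg_def column_avg_def using k
    by (intro borel_measurable_diff borel_measurable_scaleR borel_measurable_const borel_measurable_sum iterates_past) auto
  have n: "expectation (\<lambda>\<omega>. inner (noise k (fst p) (snd p) \<omega>) (zavg k \<omega> - xs)) = 0"
    "integrable P (\<lambda>\<omega>. inner (noise k (fst p) (snd p) \<omega>) (zavg k \<omega> - xs))"
    if "p \<in> {..<M} \<times> {..<m}" for p
    using that k by (auto intro!: noise_orthogonal[OF _ _ _ zm Y] square_integrable_inner square_integrable_noise Y)
  show ?thesis unfolding savg_eq using n
    by (simp add: inner_sum_left case_prod_beta Bochner_Integration.integral_sum)
qed

section \<open>Mean square consensus error\<close>

definition "zdisp k = expectation (\<lambda>\<omega>. dispersion M (\<lambda>i. z k i \<omega>))"
definition "xdisp k = expectation (\<lambda>\<omega>. dispersion M (\<lambda>i. x k i \<omega>))"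

text \<open>The spread is measured about the common centre \<open>g (zavg k \<omega>)\<close>. The
  noise enters as sigma^2 / m without a factor 1 / M, because squared norms rather than vectors are
  averaged over the machines.\<close>

lemma expectation_dispersion_sgrad:
  assumes k: "k \<le> N"
  shows "expectation (\<lambda>\<omega>. dispersion M (\<lambda>i. sgrad k i \<omega>)) \<le> 2 * \<sigma>\<^sup>2 / real m + 2 * L\<^sup>2 * zdisp k"
proof -
  let ?n = "\<lambda>i \<omega>. (norm (sgrad k i \<omega> - g (z k i \<omega>)))\<^sup>2"
  have pw: "dispersion M (\<lambda>i. sgrad k i \<omega>) \<le> (2 / real M) * (\<Sum>i<M. ?n i \<omega>) + 2 * L\<^sup>2 * dispersion M (\<lambda>i. z k i \<omega>)" for \<omega>
  proof -
    have "dispersion M (\<lambda>i. sgrad k i \<omega>) \<le> (1 / real M) * (\<Sum>i<M. (norm (sgrad k i \<omega> - g (zavg k \<omega>)))\<^sup>2)"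
      using M by (intro dispersion_le) simp
    also have "\<dots> \<le> (1 / real M) * (\<Sum>i<M. 2 * ?n i \<omega> + 2 * (L\<^sup>2 * (norm (z k i \<omega> - zavg k \<omega>))\<^sup>2))"
    proof (intro mult_left_mono sum_mono)
      fix i
      have "(norm (sgrad k i \<omega> - g (zavg k \<omega>)))\<^sup>2 \<le> 2 * ?n i \<omega> + 2 * (norm (g (z k i \<omega>) - g (zavg k \<omega>)))\<^sup>2"
        using norm_add_power2_le[of "sgrad k i \<omega> - g (z k i \<omega>)" "g (z k i \<omega>) - g (zavg k \<omega>)"] by simp
      also have "(norm (g (z k i \<omega>) - g (zavg k \<omega>)))\<^sup>2 \<le> L\<^sup>2 * (norm (z k i \<omega> - zavg k \<omega>))\<^sup>2"
        unfolding power_mult_distrib[symmetric] by (intro power_mono lip) simp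
      finally show "(norm (sgrad k i \<omega> - g (zavg k \<omega>)))\<^sup>2 \<le> 2 * ?n i \<omega> + 2 * (L\<^sup>2 * (norm (z k i \<omega> - zavg k \<omega>))\<^sup>2)"
        by simp
    qed simp
    also have "\<dots> = (2 / real M) * (\<Sum>i<M. ?n i \<omega>) + 2 * L\<^sup>2 * dispersion M (\<lambda>i. z k i \<omega>)"
      unfolding dispersion_def zavg_def by (simp add: sum.distrib algebra_simps flip: sum_distrib_left)
    finally show ?thesis .
  qed
  have ni: "integrable P (?n i)" if "i < M" for i
    using that k by (intro square_integrableD(2) square_integrable_diff square_integrable_sgrad square_integrable_g)
  have di: "integrable P (\<lambda>\<omega>. dispersion M (\<lambda>i. z k i \<omega>))"
    using k by (intro integrable_dispersion square_integrable_iterates)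
  have "expectation (\<lambda>\<omega>. dispersion M (\<lambda>i. sgrad k i \<omega>))
    \<le> expectation (\<lambda>\<omega>. (2 / real M) * (\<Sum>i<M. ?n i \<omega>) + 2 * L\<^sup>2 * dispersion M (\<lambda>i. z k i \<omega>))"
    using k by (intro integral_mono integrable_dispersion square_integrable_sgrad
        Bochner_Integration.integrable_add integrable_mult_right Bochner_Integration.integrable_sum ni di pw) auto
  also have "\<dots> = (2 / real M) * (\<Sum>i<M. expectation (?n i)) + 2 * L\<^sup>2 * zdisp k"
  proof -
    have "expectation (\<lambda>\<omega>. \<Sum>i<M. ?n i \<omega>) = (\<Sum>i<M. expectation (?n i))"
      "integrable P (\<lambda>\<omega>. \<Sum>i<M. ?n i \<omega>)"
      using ni by (auto intro!: Bochner_Integration.integral_sum Bochner_Integration.integrable_sum)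
    then show ?thesis using di by (simp add: zdisp_def)
  qed
  also have "\<dots> \<le> (2 / real M) * (real M * (\<sigma>\<^sup>2 / real m)) + 2 * L\<^sup>2 * zdisp k"
    using expectation_sgrad_noise[OF k] sum_bounded_above[of "{..<M}" "\<lambda>i. expectation (?n i)" "\<sigma>\<^sup>2 / real m"]
    by (intro add_right_mono mult_left_mono) auto
  also have "(2 / real M) * (real M * (\<sigma>\<^sup>2 / real m)) = 2 * \<sigma>\<^sup>2 / real m" using M by simp
  finally show ?thesis .
qed

text \<open>Both updates mix \<open>x k\<close> and subtract a gradient, of iteration
  \<open>k\<close> for \<open>z\<close> and of \<open>Suc k\<close> for \<open>x\<close>, so
  \<open>main\<close> covers both. Here 8/9 = 2 * 4/9, and 4 = 2 * 2 comes from splitting off first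
  the mixing and then the noise.\<close>

lemma dispersion_recursion:
  assumes k: "Suc k \<le> N"
  shows "zdisp (Suc k) \<le> 8 / 9 * xdisp k + 4 * \<eta>\<^sup>2 * (\<sigma>\<^sup>2 / real m + L\<^sup>2 * zdisp k)"
    and "xdisp (Suc k) \<le> 8 / 9 * xdisp k + 4 * \<eta>\<^sup>2 * (\<sigma>\<^sup>2 / real m + L\<^sup>2 * zdisp (Suc k))"
proof -
  have main: "expectation (\<lambda>\<omega>. dispersion M (\<lambda>i. mix M (W ^\<^sub>m t) (\<lambda>i. x k i \<omega>) i - \<eta> *\<^sub>R sgrad l i \<omega>))
    \<le> 8 / 9 * xdisp k + 4 * \<eta>\<^sup>2 * (\<sigma>\<^sup>2 / real m + L\<^sup>2 * zdisp l)" if "l \<le> N" for l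
  proof -
    let ?d = "\<lambda>\<omega>. 8 / 9 * dispersion M (\<lambda>i. x k i \<omega>) + 2 * \<eta>\<^sup>2 * dispersion M (\<lambda>i. sgrad l i \<omega>)"
    have pw: "dispersion M (\<lambda>i. mix M (W ^\<^sub>m t) (\<lambda>i. x k i \<omega>) i - \<eta> *\<^sub>R sgrad l i \<omega>) \<le> ?d \<omega>" for \<omega>
    proof -
      have "(mixing_rate W ^ t)\<^sup>2 * dispersion M (\<lambda>i. x k i \<omega>) \<le> 4 / 9 * dispersion M (\<lambda>i. x k i \<omega>)"
        by (intro mult_right_mono contraction) (simp add: dispersion_def sum_nonneg)
      then show ?thesis using dispersion_mix_step_le[OF W M rho, of t "\<lambda>i. x k i \<omega>" \<eta> "\<lambda>i. sgrad l i \<omega>"] by simp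
    qed
    have i: "integrable P (\<lambda>\<omega>. dispersion M (\<lambda>i. x k i \<omega>))" "integrable P (\<lambda>\<omega>. dispersion M (\<lambda>i. sgrad l i \<omega>))"
      using k that by (intro integrable_dispersion square_integrable_iterates square_integrable_sgrad; simp)+
    have "integrable P (\<lambda>\<omega>. dispersion M (\<lambda>i. mix M (W ^\<^sub>m t) (\<lambda>i. x k i \<omega>) i - \<eta> *\<^sub>R sgrad l i \<omega>))"
      unfolding mix_def using k that
      by (intro integrable_dispersion square_integrable_diff square_integrable_scaleR square_integrable_sum
          square_integrable_iterates square_integrable_sgrad) auto
    then have "expectation (\<lambda>\<omega>. dispersion M (\<lambda>i. mix M (W ^\<^sub>m t) (\<lambda>i. x k i \<omega>) i - \<eta> *\<^sub>R sgrad l i \<omega>)) \<le> expectation ?d"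
      using i by (intro integral_mono pw) auto
    also have "\<dots> = 8 / 9 * xdisp k + 2 * \<eta>\<^sup>2 * expectation (\<lambda>\<omega>. dispersion M (\<lambda>i. sgrad l i \<omega>))"
      using i by (simp add: xdisp_def)
    also have "\<dots> \<le> 8 / 9 * xdisp k + 2 * \<eta>\<^sup>2 * (2 * \<sigma>\<^sup>2 / real m + 2 * L\<^sup>2 * zdisp l)"
      using expectation_dispersion_sgrad[OF that] by (intro add_left_mono mult_left_mono) auto
    finally show ?thesis by (simp add: algebra_simps)
  qed
  show "zdisp (Suc k) \<le> 8 / 9 * xdisp k + 4 * \<eta>\<^sup>2 * (\<sigma>\<^sup>2 / real m + L\<^sup>2 * zdisp k)"
    using main[of k] k unfolding zdisp_def iterates_simps by simp
  show "xdisp (Suc k) \<le> 8 / 9 * xdisp k + 4 * \<eta>\<^sup>2 * (\<sigma>\<^sup>2 / real m + L\<^sup>2 * zdisp (Suc k))"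
    using main[of "Suc k"] k unfolding xdisp_def iterates_simps(4) by simp
qed

lemma step_small: "\<eta>\<^sup>2 * L\<^sup>2 \<le> 1 / (10272 * real M)"
  using step M by (simp add: power_mult_distrib field_simps)

text \<open>The recursion K = 8/9 K + 4 has the fixed point 36; raising it to 37 absorbs the
  feedback through \<open>L\<^sup>2 * zdisp\<close>, whose factor is at most 4 / 20544 since
  \<open>M \<ge> 2\<close>.\<close>

lemma dispersion_bound:
  assumes "k \<le> N"
  shows "zdisp k \<le> 37 * \<eta>\<^sup>2 * \<sigma>\<^sup>2 / real m" and "xdisp k \<le> 37 * \<eta>\<^sup>2 * \<sigma>\<^sup>2 / real m"
proof -
  let ?K = "37 * \<eta>\<^sup>2 * \<sigma>\<^sup>2 / real m"
  have K0: "?K \<ge> 0" by simp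
  have "1 / (10272 * real M) \<le> 1 / 20544" using M by (intro divide_left_mono) auto
  then have s: "\<eta>\<^sup>2 * L\<^sup>2 \<le> 1 / 20544" using step_small by linarith
  have close: "8 / 9 * a + 4 * \<eta>\<^sup>2 * (\<sigma>\<^sup>2 / real m + L\<^sup>2 * b) \<le> ?K" if "a \<le> ?K" "b \<le> ?K" for a b
  proof -
    have "\<eta>\<^sup>2 * L\<^sup>2 * b \<le> \<eta>\<^sup>2 * L\<^sup>2 * ?K" by (intro mult_left_mono that) simp
    also have "\<dots> \<le> 1 / 20544 * ?K" by (intro mult_right_mono s K0)
    finally have "8 / 9 * a + 4 * (\<eta>\<^sup>2 * \<sigma>\<^sup>2 / real m) + 4 * (\<eta>\<^sup>2 * L\<^sup>2 * b) \<le> 8 / 9 * ?K + 4 * (\<eta>\<^sup>2 * \<sigma>\<^sup>2 / real m) + 4 * (1 / 20544 * ?K)"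
      using that(1) by (intro add_mono mult_left_mono) auto
    also have "\<dots> = (8 / 9 * 37 + 4 + 4 * 37 / 20544) * (\<eta>\<^sup>2 * \<sigma>\<^sup>2 / real m)" by (simp add: algebra_simps)
    also have "\<dots> \<le> 37 * (\<eta>\<^sup>2 * \<sigma>\<^sup>2 / real m)" by (intro mult_right_mono) auto
    finally show ?thesis by (simp add: algebra_simps)
  qed
  have "zdisp k \<le> ?K \<and> xdisp k \<le> ?K" using assms
  proof (induction k)
    case 0
    then show ?case using K0 by (simp add: zdisp_def xdisp_def iterates_simps dispersion_def column_avg_def)
  next
    case (Suc k)
    then have IH: "zdisp k \<le> ?K" "xdisp k \<le> ?K" by auto
    \<comment> \<open>The bound for \<open>z\<close> comes first, because the recursion for
      \<open>xdisp (Suc k)\<close> refers to \<open>zdisp (Suc k)\<close>.\<close>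
    have z: "zdisp (Suc k) \<le> ?K" using dispersion_recursion(1)[OF Suc.prems] close[OF IH(2) IH(1)] by linarith
    moreover have "xdisp (Suc k) \<le> ?K" using dispersion_recursion(2)[OF Suc.prems] close[OF IH(2) z] by linarith
    ultimately show ?case by blast
  qed
  then show "zdisp k \<le> ?K" "xdisp k \<le> ?K" by auto
qed

section \<open>Energy and drift of the averaged iterates\<close>

definition "xerr k = expectation (\<lambda>\<omega>. (norm (xavg k \<omega> - xs))\<^sup>2)"
definition "smean k = expectation (\<lambda>\<omega>. (norm (savg k \<omega>))\<^sup>2)"
definition "sdrift k = expectation (\<lambda>\<omega>. (norm (savg (Suc k) \<omega> - savg k \<omega>))\<^sup>2)"

lemma energy_decrease:
  assumes k: "Suc k \<le> N"
  shows "xerr (Suc k) \<le> xerr k + 2 * \<eta> * L * zdisp (Suc k) + \<eta>\<^sup>2 * sdrift k - \<eta>\<^sup>2 * smean k"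
proof -
  let ?n = "\<lambda>\<omega>. inner (savg (Suc k) \<omega> - gavg (Suc k) \<omega>) (zavg (Suc k) \<omega> - xs)"
  let ?e = "\<lambda>\<omega>. (norm (xavg k \<omega> - xs))\<^sup>2 - 2 * \<eta> * ?n \<omega> + 2 * \<eta> * L * dispersion M (\<lambda>i. z (Suc k) i \<omega>)
    + \<eta>\<^sup>2 * (norm (savg (Suc k) \<omega> - savg k \<omega>))\<^sup>2 - \<eta>\<^sup>2 * (norm (savg k \<omega>))\<^sup>2"
  have pw: "(norm (xavg (Suc k) \<omega> - xs))\<^sup>2 \<le> ?e \<omega>" for \<omega>
  proof -
    have "inner (gavg (Suc k) \<omega>) (zavg (Suc k) \<omega> - xs) \<ge> - L * dispersion M (\<lambda>i. z (Suc k) i \<omega>)"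
      unfolding gavg_def zavg_def using M by (intro minty_column_avg lip minty) simp
    then have "inner (savg (Suc k) \<omega>) (zavg (Suc k) \<omega> - xs) \<ge> ?n \<omega> - L * dispersion M (\<lambda>i. z (Suc k) i \<omega>)"
      by (simp add: inner_diff_left)
    from mult_left_mono[OF this, of "2 * \<eta>"] eta
    have "2 * \<eta> * inner (savg (Suc k) \<omega>) (zavg (Suc k) \<omega> - xs) \<ge> 2 * \<eta> * ?n \<omega> - 2 * \<eta> * L * dispersion M (\<lambda>i. z (Suc k) i \<omega>)"
      by (simp add: right_diff_distrib mult.assoc)
    moreover have "(norm (xavg (Suc k) \<omega> - xs))\<^sup>2 = (norm (xavg k \<omega> - xs))\<^sup>2
        - 2 * \<eta> * inner (savg (Suc k) \<omega>) (zavg (Suc k) \<omega> - xs)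
        + \<eta>\<^sup>2 * (norm (savg (Suc k) \<omega> - savg k \<omega>))\<^sup>2 - \<eta>\<^sup>2 * (norm (savg k \<omega>))\<^sup>2"
      unfolding averages_simps by (rule optimistic_step_energy)
    ultimately show ?thesis by linarith
  qed
  have sq: "square_integrable P (\<lambda>\<omega>. xavg l \<omega> - xs)" if "l \<le> N" for l
    using that by (intro square_integrable_diff square_integrable_averages square_integrable_const)
  have i1: "integrable P (\<lambda>\<omega>. (norm (xavg l \<omega> - xs))\<^sup>2)" if "l \<le> N" for l
    using sq[OF that] by (rule square_integrableD)
  have i2: "integrable P ?n"
    using k by (intro square_integrable_inner square_integrable_diff square_integrable_averages square_integrable_const)
  have i3: "integrable P (\<lambda>\<omega>. dispersion M (\<lambda>i. z (Suc k) i \<omega>))"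
    using k by (intro integrable_dispersion square_integrable_iterates)
  have i4: "integrable P (\<lambda>\<omega>. (norm (savg (Suc k) \<omega> - savg k \<omega>))\<^sup>2)" "integrable P (\<lambda>\<omega>. (norm (savg k \<omega>))\<^sup>2)"
    using k by (intro square_integrableD(2) square_integrable_diff square_integrable_averages; simp)+
  have "xerr (Suc k) \<le> expectation ?e"
    unfolding xerr_def using k i1[of "Suc k"] i1[of k] i2 i3 i4 by (intro integral_mono pw) auto
  also have "\<dots> = xerr k - 2 * \<eta> * expectation ?n + 2 * \<eta> * L * zdisp (Suc k) + \<eta>\<^sup>2 * sdrift k - \<eta>\<^sup>2 * smean k"
    unfolding xerr_def sdrift_def smean_def zdisp_def using k i1[of k] i2 i3 i4 by simp
  finally show ?thesis using savg_noise_orthogonal[OF k] by simp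
qed

lemma expectation_gavg_error:
  assumes "k \<le> N"
  shows "expectation (\<lambda>\<omega>. (norm (gavg k \<omega> - g (zavg k \<omega>)))\<^sup>2) \<le> L\<^sup>2 * zdisp k"
proof -
  have di: "integrable P (\<lambda>\<omega>. dispersion M (\<lambda>i. z k i \<omega>))"
    using assms by (intro integrable_dispersion square_integrable_iterates)
  have "expectation (\<lambda>\<omega>. (norm (gavg k \<omega> - g (zavg k \<omega>)))\<^sup>2) \<le> expectation (\<lambda>\<omega>. L\<^sup>2 * dispersion M (\<lambda>i. z k i \<omega>))"
  proof (intro integral_mono)
    show "integrable P (\<lambda>\<omega>. (norm (gavg k \<omega> - g (zavg k \<omega>)))\<^sup>2)"
      using assms by (intro square_integrableD(2) square_integrable_diff square_integrable_averages square_integrable_g_zavg)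
    show "integrable P (\<lambda>\<omega>. L\<^sup>2 * dispersion M (\<lambda>i. z k i \<omega>))" using di by simp
    show "(norm (gavg k \<omega> - g (zavg k \<omega>)))\<^sup>2 \<le> L\<^sup>2 * dispersion M (\<lambda>i. z k i \<omega>)" for \<omega>
      unfolding gavg_def zavg_def using M by (intro column_avg_lipschitz_error lip) simp
  qed
  then show ?thesis using di by (simp add: zdisp_def)
qed

text \<open>Five contributions, hence the factor 5: noise and consensus error at both iterations,
  and the change of \<open>g\<close> along the averaged iterates.\<close>

lemma drift_bound:
  assumes k: "Suc k \<le> N"
  shows "sdrift k \<le> 5 * (2 * (\<sigma>\<^sup>2 / (real m * real M)) + L\<^sup>2 * zdisp (Suc k) + L\<^sup>2 * zdisp k
    + L\<^sup>2 * expectation (\<lambda>\<omega>. (norm (zavg (Suc k) \<omega> - zavg k \<omega>))\<^sup>2))"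
proof -
  let ?n = "\<lambda>k \<omega>. (norm (savg k \<omega> - gavg k \<omega>))\<^sup>2" and ?b = "\<lambda>k \<omega>. (norm (gavg k \<omega> - g (zavg k \<omega>)))\<^sup>2"
  let ?z = "\<lambda>\<omega>. (norm (zavg (Suc k) \<omega> - zavg k \<omega>))\<^sup>2"
  let ?e = "\<lambda>\<omega>. 5 * (?n (Suc k) \<omega> + ?n k \<omega> + ?b (Suc k) \<omega> + ?b k \<omega> + L\<^sup>2 * ?z \<omega>)"
  have pw: "(norm (savg (Suc k) \<omega> - savg k \<omega>))\<^sup>2 \<le> ?e \<omega>" for \<omega>
  proof -
    have "(norm (g (zavg (Suc k) \<omega>) - g (zavg k \<omega>)))\<^sup>2 \<le> L\<^sup>2 * ?z \<omega>"
      unfolding power_mult_distrib[symmetric] by (intro power_mono lip) simp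
    moreover have "savg (Suc k) \<omega> - savg k \<omega> = (savg (Suc k) \<omega> - gavg (Suc k) \<omega>) + (gavg k \<omega> - savg k \<omega>)
      + (gavg (Suc k) \<omega> - g (zavg (Suc k) \<omega>)) + (g (zavg k \<omega>) - gavg k \<omega>) + (g (zavg (Suc k) \<omega>) - g (zavg k \<omega>))"
      by simp
    then have "(norm (savg (Suc k) \<omega> - savg k \<omega>))\<^sup>2 \<le> 5 * (?n (Suc k) \<omega> + ?n k \<omega> + ?b (Suc k) \<omega> + ?b k \<omega>
      + (norm (g (zavg (Suc k) \<omega>) - g (zavg k \<omega>)))\<^sup>2)"
      using norm_sum5_power2_le[of "savg (Suc k) \<omega> - gavg (Suc k) \<omega>" "gavg k \<omega> - savg k \<omega>"
          "gavg (Suc k) \<omega> - g (zavg (Suc k) \<omega>)" "g (zavg k \<omega>) - gavg k \<omega>" "g (zavg (Suc k) \<omega>) - g (zavg k \<omega>)"]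
      by (simp only: norm_minus_commute)
    ultimately show ?thesis unfolding distrib_left by linarith
  qed
  have i: "integrable P (?n l)" "integrable P (?b l)" if "l \<le> N" for l
    using that by (intro square_integrableD(2) square_integrable_diff square_integrable_averages square_integrable_g_zavg; simp)+
  have iz: "integrable P ?z" "integrable P (\<lambda>\<omega>. (norm (savg (Suc k) \<omega> - savg k \<omega>))\<^sup>2)"
    using k by (intro square_integrableD(2) square_integrable_diff square_integrable_averages; simp)+
  have "sdrift k \<le> expectation ?e"
    unfolding sdrift_def using k i[of "Suc k"] i[of k] iz by (intro integral_mono pw) auto
  also have "\<dots> = 5 * (expectation (?n (Suc k)) + expectation (?n k) + expectation (?b (Suc k)) + expectation (?b k)
      + L\<^sup>2 * expectation ?z)"
    using k i[of "Suc k"] i[of k] iz by simp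
  also have "\<dots> \<le> 5 * (\<sigma>\<^sup>2 / (real m * real M) + \<sigma>\<^sup>2 / (real m * real M) + L\<^sup>2 * zdisp (Suc k) + L\<^sup>2 * zdisp k
      + L\<^sup>2 * expectation ?z)"
    using k expectation_savg_noise[of k] expectation_savg_noise[of "Suc k"]
      expectation_gavg_error[of k] expectation_gavg_error[of "Suc k"] by (intro mult_left_mono add_mono) auto
  finally show ?thesis by (simp only: mult_2)
qed

text \<open>Eliminating \<open>xavg\<close> gives the move -eta (2 u_k - u_(k-1)), regrouped as -eta
  (u_k + (u_k - u_(k-1))). At \<open>k = 0\<close> everything starts at zero, so there is no
  previous drift.\<close>

lemma zavg_move:
  assumes k: "Suc k \<le> N"
  shows "expectation (\<lambda>\<omega>. (norm (zavg (Suc k) \<omega> - zavg k \<omega>))\<^sup>2)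
    \<le> 2 * \<eta>\<^sup>2 * (smean k + (case k of 0 \<Rightarrow> 0 | Suc l \<Rightarrow> sdrift l))"
proof (cases k)
  case 0
  have "expectation (\<lambda>\<omega>. (norm (zavg (Suc k) \<omega> - zavg k \<omega>))\<^sup>2) = \<eta>\<^sup>2 * smean k"
    by (simp add: 0 averages_simps smean_def power_mult_distrib)
  moreover have "smean k \<ge> 0" by (simp add: smean_def)
  ultimately show ?thesis by (simp add: 0)
next
  case (Suc l)
  let ?e = "\<lambda>\<omega>. \<eta>\<^sup>2 * (2 * (norm (savg k \<omega>))\<^sup>2 + 2 * (norm (savg (Suc l) \<omega> - savg l \<omega>))\<^sup>2)"
  have pw: "(norm (zavg (Suc k) \<omega> - zavg k \<omega>))\<^sup>2 \<le> ?e \<omega>" for \<omega>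
  proof -
    have "zavg (Suc k) \<omega> - zavg k \<omega> = - (\<eta> *\<^sub>R (savg k \<omega> + (savg (Suc l) \<omega> - savg l \<omega>)))"
      unfolding Suc averages_simps by (simp add: scaleR_add_right scaleR_diff_right)
    then have "(norm (zavg (Suc k) \<omega> - zavg k \<omega>))\<^sup>2 = \<eta>\<^sup>2 * (norm (savg k \<omega> + (savg (Suc l) \<omega> - savg l \<omega>)))\<^sup>2"
      by (simp only: norm_minus_cancel norm_scaleR power_mult_distrib power2_abs)
    then show ?thesis by (simp only:) (intro mult_left_mono norm_add_power2_le, simp)
  qed
  have i: "integrable P (\<lambda>\<omega>. (norm (savg k \<omega>))\<^sup>2)" "integrable P (\<lambda>\<omega>. (norm (savg (Suc l) \<omega> - savg l \<omega>))\<^sup>2)"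
    "integrable P (\<lambda>\<omega>. (norm (zavg (Suc k) \<omega> - zavg k \<omega>))\<^sup>2)"
    using k Suc by (intro square_integrableD(2) square_integrable_diff square_integrable_averages; simp)+
  have "expectation (\<lambda>\<omega>. (norm (zavg (Suc k) \<omega> - zavg k \<omega>))\<^sup>2) \<le> expectation ?e"
    using i by (intro integral_mono pw) auto
  also have "\<dots> = 2 * \<eta>\<^sup>2 * (smean k + sdrift l)"
    using i unfolding smean_def sdrift_def by (simp add: algebra_simps)
  finally show ?thesis by (simp add: Suc)
qed

text \<open>Passing from \<open>savg k\<close> to \<open>g (zavg k)\<close> through
  \<open>gavg k\<close> adds the noise and the consensus error, three terms in all.\<close>

lemma expectation_g_zavg:
  assumes k: "k \<le> N"
  shows "expectation (\<lambda>\<omega>. (norm (g (zavg k \<omega>)))\<^sup>2) \<le> 3 * (smean k + \<sigma>\<^sup>2 / (real m * real M) + L\<^sup>2 * zdisp k)"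
proof -
  let ?n = "\<lambda>\<omega>. (norm (savg k \<omega> - gavg k \<omega>))\<^sup>2" and ?b = "\<lambda>\<omega>. (norm (gavg k \<omega> - g (zavg k \<omega>)))\<^sup>2"
  let ?e = "\<lambda>\<omega>. 3 * ((norm (savg k \<omega>))\<^sup>2 + ?n \<omega> + ?b \<omega>)"
  have pw: "(norm (g (zavg k \<omega>)))\<^sup>2 \<le> ?e \<omega>" for \<omega>
    using norm_sum3_power2_le[of "savg k \<omega>" "gavg k \<omega> - savg k \<omega>" "g (zavg k \<omega>) - gavg k \<omega>"]
    by (simp add: norm_minus_commute)
  have i: "integrable P ?n" "integrable P ?b" "integrable P (\<lambda>\<omega>. (norm (savg k \<omega>))\<^sup>2)" "integrable P (\<lambda>\<omega>. (norm (g (zavg k \<omega>)))\<^sup>2)"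
    using k by (intro square_integrableD(2) square_integrable_diff square_integrable_averages square_integrable_g_zavg; simp)+
  have "expectation (\<lambda>\<omega>. (norm (g (zavg k \<omega>)))\<^sup>2) \<le> expectation ?e"
    using i by (intro integral_mono pw) auto
  also have "\<dots> = 3 * (smean k + expectation ?n + expectation ?b)" using i by (simp add: smean_def)
  also have "\<dots> \<le> 3 * (smean k + \<sigma>\<^sup>2 / (real m * real M) + L\<^sup>2 * zdisp k)"
    using k expectation_savg_noise[of k] expectation_gavg_error[of k] by (intro mult_left_mono add_mono) auto
  finally show ?thesis .
qed

lemma mean_square_gradient_bound:
  assumes N: "N \<ge> 1"
  shows "1 / real N * (\<Sum>k<N. expectation (\<lambda>\<omega>. (norm (g (zavg k \<omega>)))\<^sup>2))
    \<le> 8 * ((norm xs)\<^sup>2 / (\<eta>\<^sup>2 * real N) + 20 * \<sigma>\<^sup>2 / (real m * real M) + 48 * \<sigma>\<^sup>2 / sqrt (real m * real M))"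
proof -
  define v where "v = \<sigma>\<^sup>2 / (real m * real M)"
  define s where "s = \<sigma>\<^sup>2 / sqrt (real m * real M)"
  define K where "K = 37 * \<eta>\<^sup>2 * \<sigma>\<^sup>2 / real m"
  have v0: "v \<ge> 0" and s0: "s \<ge> 0" and K0: "K \<ge> 0" by (simp_all add: v_def s_def K_def)
  have Mp: "real M > 0" and mp: "real m \<ge> 1" using M m by auto
  have zdisp: "zdisp k \<le> K" if "k \<le> N" for k using dispersion_bound(1)[OF that] by (simp add: K_def)
  have LK: "L\<^sup>2 * K \<le> 1 / 100 * v"
  proof -
    have "L\<^sup>2 * K = 37 * (\<eta>\<^sup>2 * L\<^sup>2) * (\<sigma>\<^sup>2 / real m)" by (simp add: K_def)
    also have "\<dots> \<le> 37 * (1 / (10272 * real M)) * (\<sigma>\<^sup>2 / real m)"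
      by (intro mult_right_mono mult_left_mono step_small) auto
    also have "\<dots> = 37 / 10272 * v" by (simp add: v_def)
    also have "\<dots> \<le> 1 / 100 * v" by (intro mult_right_mono v0) simp
    finally show ?thesis .
  qed
  have LKs: "2 * L * K / \<eta> \<le> s"
  proof -
    have "(\<eta> * L * sqrt (real M))\<^sup>2 = real M * (\<eta> * L)\<^sup>2"
      by (simp add: power_mult_distrib)
    also have "\<dots> \<le> 1 / 10272" using step by linarith
    also have "\<dots> \<le> (1 / 100)\<^sup>2" by (simp add: power2_eq_square)
    finally have "(\<eta> * L * sqrt (real M))\<^sup>2 \<le> (1 / 100)\<^sup>2" .
    then have "\<eta> * L * sqrt (real M) \<le> 1 / 100" by (rule power2_le_imp_le) simp
    \<comment> \<open>74 is 2 * 37, with 37 from \<open>K\<close>.\<close>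
    then have "74 * (\<eta> * L) * sqrt (real M) \<le> 1" by simp
    then have e: "74 * (\<eta> * L) \<le> 1 / sqrt (real M)" using Mp by (simp add: pos_le_divide_eq)
    have "2 * L * K / \<eta> = 74 * (\<eta> * L) * (\<sigma>\<^sup>2 / real m)"
      using eta by (simp add: K_def power2_eq_square)
    also have "\<dots> \<le> 1 / sqrt (real M) * (\<sigma>\<^sup>2 / real m)" by (intro mult_right_mono e) simp
    also have "\<dots> \<le> 1 / sqrt (real M) * (\<sigma>\<^sup>2 / sqrt (real m))"
    proof -
      have "sqrt (real m) \<le> real m" using mp by (intro real_le_lsqrt) (auto simp: self_le_power)
      then show ?thesis using mp by (intro mult_left_mono divide_left_mono) auto
    qed
    also have "\<dots> = s" by (simp add: s_def real_sqrt_mult)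
    finally show ?thesis .
  qed
  \<comment> \<open>The part of \<open>drift_bound\<close> independent of the iterates: 5 times two
    noise terms and two consensus terms.\<close>
  define B where "B = 10 * v + 10 * (L\<^sup>2 * K)"
  \<comment> \<open>5 / 36 is 10 / 72, the value of the left side at \<eta> L = 1 / (6 sqrt 2); the
    bound in force here is smaller.\<close>
  have small: "10 * (L\<^sup>2 * \<eta>\<^sup>2) \<le> 5 / 36"
  proof -
    have "1 / (10272 * real M) \<le> 1 / 10272" using M by (intro divide_left_mono) auto
    then show ?thesis using step_small by (simp add: mult.commute)
  qed
  have drift: "sdrift k \<le> B + 5 / 36 * (smean k + (case k of 0 \<Rightarrow> 0 | Suc l \<Rightarrow> sdrift l))" if "k < N" for k
  proof -
    let ?r = "smean k + (case k of 0 \<Rightarrow> 0 | Suc l \<Rightarrow> sdrift l)"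
    have r: "?r \<ge> 0" by (auto simp: smean_def sdrift_def split: nat.split)
    have "L\<^sup>2 * zdisp (Suc k) \<le> L\<^sup>2 * K" "L\<^sup>2 * zdisp k \<le> L\<^sup>2 * K"
      using that by (intro mult_left_mono zdisp; simp)+
    moreover have "L\<^sup>2 * expectation (\<lambda>\<omega>. (norm (zavg (Suc k) \<omega> - zavg k \<omega>))\<^sup>2) \<le> L\<^sup>2 * (2 * \<eta>\<^sup>2 * ?r)"
      using that by (intro mult_left_mono zavg_move) auto
    ultimately have "sdrift k \<le> B + 10 * (L\<^sup>2 * \<eta>\<^sup>2) * ?r"
      using drift_bound[of k] that unfolding B_def v_def by simp
    also have "\<dots> \<le> B + 5 / 36 * ?r" by (intro add_left_mono mult_right_mono small r)
    finally show ?thesis .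
  qed
  have "\<eta>\<^sup>2 * (\<Sum>k<N. smean k) \<le> 31 / 26 * (xerr 0 + real N * (2 * \<eta> * L * K)) + 36 / 26 * (\<eta>\<^sup>2 * (real N * B))"
  proof (rule optimistic_sum_bound)
    show "0 \<le> sdrift k" for k by (simp add: sdrift_def)
    show "xerr N \<ge> 0" by (simp add: xerr_def)
    show "xerr (Suc k) \<le> xerr k + 2 * \<eta> * L * K + \<eta>\<^sup>2 * sdrift k - \<eta>\<^sup>2 * smean k" if "k < N" for k
    proof -
      have "2 * \<eta> * L * zdisp (Suc k) \<le> 2 * \<eta> * L * K" using that eta L by (intro mult_left_mono zdisp) auto
      then show ?thesis using energy_decrease[of k] that by simp
    qed
    show "sdrift 0 \<le> B + 5 / 36 * smean 0" if "0 < N" using drift[OF that] by simp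
    show "sdrift (Suc k) \<le> B + 5 / 36 * (smean (Suc k) + sdrift k)" if "Suc k < N" for k
      using drift[OF that] by simp
  qed simp
  then have "(\<eta>\<^sup>2 * (\<Sum>k<N. smean k)) / (\<eta>\<^sup>2 * real N) \<le> (31 / 26 * (xerr 0 + real N * (2 * \<eta> * L * K)) + 36 / 26 * (\<eta>\<^sup>2 * (real N * B))) / (\<eta>\<^sup>2 * real N)"
    by (rule divide_right_mono) simp
  also have "\<dots> = 31 / 26 * (xerr 0 / (\<eta>\<^sup>2 * real N) + 2 * L * K / \<eta>) + 36 / 26 * B"
    using eta N by (simp add: power2_eq_square field_simps)
  also have "xerr 0 = (norm xs)\<^sup>2" by (simp add: xerr_def averages_simps prob_space)
  also have "(\<eta>\<^sup>2 * (\<Sum>k<N. smean k)) / (\<eta>\<^sup>2 * real N) = (\<Sum>k<N. smean k) / real N" using eta by simp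
  finally have S: "(\<Sum>k<N. smean k) / real N \<le> 31 / 26 * ((norm xs)\<^sup>2 / (\<eta>\<^sup>2 * real N) + 2 * L * K / \<eta>) + 36 / 26 * B" .
  have "(\<Sum>k<N. expectation (\<lambda>\<omega>. (norm (g (zavg k \<omega>)))\<^sup>2)) \<le> (\<Sum>k<N. 3 * smean k + 3 * (v + L\<^sup>2 * K))"
  proof (rule sum_mono)
    fix k assume "k \<in> {..<N}"
    then have k: "k \<le> N" by simp
    have "L\<^sup>2 * zdisp k \<le> L\<^sup>2 * K" by (intro mult_left_mono zdisp k) simp
    then show "expectation (\<lambda>\<omega>. (norm (g (zavg k \<omega>)))\<^sup>2) \<le> 3 * smean k + 3 * (v + L\<^sup>2 * K)"
      using expectation_g_zavg[OF k] by (simp add: v_def)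
  qed
  then have "1 / real N * (\<Sum>k<N. expectation (\<lambda>\<omega>. (norm (g (zavg k \<omega>)))\<^sup>2)) \<le> 1 / real N * (\<Sum>k<N. 3 * smean k + 3 * (v + L\<^sup>2 * K))"
    by (rule mult_left_mono) simp
  also have "\<dots> = 3 * ((\<Sum>k<N. smean k) / real N) + 3 * (v + L\<^sup>2 * K)"
    using N by (simp add: sum.distrib add_divide_distrib flip: sum_distrib_left)
  also have "\<dots> \<le> 8 * ((norm xs)\<^sup>2 / (\<eta>\<^sup>2 * real N) + 20 * v + 48 * s)"
  proof -
    \<comment> \<open>After substitution the coefficients on the left are 93/26 for \<open>d\<close>
      and for \<open>s\<close> and about 45 for \<open>v\<close>, against 8, 384 and 160 on the
      right.\<close>
    have numbers: "3 * a + 3 * (v + k) \<le> 8 * (d + 20 * v + 48 * s)"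
      if "d \<ge> 0" "a \<le> 31 / 26 * (d + q) + 36 / 26 * (10 * v + 10 * k)" "k \<le> 1 / 100 * v" "q \<le> s" for a d k q
      using that v0 s0 by (simp add: field_simps)
    show ?thesis by (rule numbers[OF _ S[unfolded B_def] LK LKs]) simp
  qed
  finally show ?thesis by (simp add: v_def s_def)
qed

end

section \<open>From the bounds on \<open>t\<close> and \<open>\<eta>\<close> to the final
  estimate\<close>

lemma mixing_power_le:
  fixes \<rho> \<sigma> G :: real and M m t :: nat
  assumes rho: "0 \<le> \<rho>" "\<rho> < 1" and pow: "\<rho> ^ t < 1" and "M \<ge> 2" and sigma: "\<sigma> > 0"
    and t: "real t \<ge> log (1 / \<rho>) (1 + real M * sqrt (real m * real M * G\<^sup>2 + \<sigma>\<^sup>2) / (4 * \<sigma>))"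
  shows "\<rho> ^ t \<le> 2 / 3"
proof (cases "\<rho> = 0")
  \<comment> \<open>Here \<open>log (1 / \<rho>)\<close> is the junk value \<open>0\<close>, so the assumption on \<open>t\<close> is void.\<close>
  case True
  then have "t \<noteq> 0" using pow by (cases t) auto
  then show ?thesis using True by (simp add: power_0_left)
next
  case False
  then have pos: "0 < \<rho>" using rho by simp
  define B where "B = 1 + real M * sqrt (real m * real M * G\<^sup>2 + \<sigma>\<^sup>2) / (4 * \<sigma>)"
  \<comment> \<open>Dropping the \<open>G\<close> part of the root and using
    \<open>M \<ge> 2\<close> bounds the argument of the logarithm below by 1 + 2/4.\<close>
  have "\<sigma> \<le> sqrt (real m * real M * G\<^sup>2 + \<sigma>\<^sup>2)" using sigma by (intro real_le_rsqrt) simp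
  then have "2 * \<sigma> \<le> real M * sqrt (real m * real M * G\<^sup>2 + \<sigma>\<^sup>2)"
    using assms(4) sigma by (intro mult_mono) auto
  then have B: "3 / 2 \<le> B" using sigma by (simp add: B_def field_simps)
  have "B \<le> (1 / \<rho>) powr real t"
    using t pos rho B unfolding B_def[symmetric] by (subst (asm) log_le_iff) auto
  also have "\<dots> = (1 / \<rho>) ^ t" using pos by (simp add: powr_realpow)
  finally have "3 / 2 \<le> 1 / \<rho> ^ t" using B by (simp add: power_divide)
  then show ?thesis using pos by (simp add: field_simps)
qed

lemma step_size_bound:
  fixes \<eta> L c :: real
  assumes "\<eta> > 0" "L > 0" "c > 0" and "\<eta> \<le> a / (sqrt c * L)" "a \<le> 1"
  shows "c * (\<eta> * L)\<^sup>2 \<le> 1"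
proof -
  have "\<eta> * L * sqrt c \<le> 1" using assms by (simp add: pos_le_divide_eq mult_ac)
  then have "(\<eta> * L * sqrt c)\<^sup>2 \<le> 1" using assms by (simp add: power_le_one)
  then show ?thesis using assms by (simp add: power_mult_distrib mult.commute)
qed

theorem theorem1:
  fixes \<D> :: "'s measure"
    and f :: "'a::euclidean_space \<Rightarrow> 'b::euclidean_space \<Rightarrow> 's \<Rightarrow> real"
    and F :: "'a \<Rightarrow> 'b \<Rightarrow> real"
    and g :: "'a \<times> 'b \<Rightarrow> 'a \<times> 'b"
    and gs :: "'a \<times> 'b \<Rightarrow> 's \<Rightarrow> 'a \<times> 'b"
    and L \<sigma> G D \<eta> \<rho> c :: real
    and xstar x0 :: "'a \<times> 'b"
    and M m N t :: nat
    and W :: "real mat"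
    and P :: "'w measure"
    and \<xi> :: "nat \<Rightarrow> nat \<Rightarrow> nat \<Rightarrow> 'w \<Rightarrow> 's"
    and zbar :: "nat \<Rightarrow> 'w \<Rightarrow> 'a \<times> 'b"
  defines "F \<equiv> expected_obj \<D> f"
    and "g \<equiv> saddle_grad F"
    and "gs \<equiv> \<lambda>x s. saddle_grad (\<lambda>u v. f u v s) x"
    and "\<rho> \<equiv> mixing_rate W"
    and "c \<equiv> 321"
    and "x0 \<equiv> 0"
    and "zbar \<equiv> \<lambda>k \<omega>. column_avg M (dposg_Z gs M W t m \<eta> (\<lambda>k i j. \<xi> k i j \<omega>) k)"
  assumes "prob_space \<D>"
    and "\<And>u v. integrable \<D> (f u v)"
    and "\<And>s. s \<in> space \<D> \<Longrightarrow> partially_differentiable (\<lambda>u v. f u v s)"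
    and "partially_differentiable F"
    and "L > 0" and "\<sigma> > 0" and "D > 0"
    and "\<And>x1 x2. norm (g x1 - g x2) \<le> L * norm (x1 - x2)"
    and "\<And>x. integrable \<D> (gs x)"
    and "\<And>x. (\<integral>s. gs x s \<partial>\<D>) = g x"
    and "\<And>x. integrable \<D> (\<lambda>s. (norm (gs x s - g x))\<^sup>2)"
    and "\<And>x. (\<integral>s. (norm (gs x s - g x))\<^sup>2 \<partial>\<D>) \<le> \<sigma>\<^sup>2"
    and "\<And>x. norm (g x) \<le> G"
    and "\<And>x. g x \<bullet> (x - xstar) \<ge> 0"
    and "M \<ge> 1" and "m \<ge> 1" and "N \<ge> 1"
    and "sym_doubly_stochastic M W"
    and "\<rho> < 1"
    and "prob_space P"
    and "prob_space.indep_vars P (\<lambda>_. \<D>) (\<lambda>(k, i, j). \<xi> k i j) ({..N} \<times> {..<M} \<times> {..<m})"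
    and "\<And>k i j. k \<le> N \<Longrightarrow> i < M \<Longrightarrow> j < m \<Longrightarrow> distr P \<D> (\<xi> k i j) = \<D>"
    and "norm xstar \<le> D / 2"
    and "\<And>k. k \<le> N \<Longrightarrow> AE \<omega> in P. norm (zbar k \<omega>) \<le> D / 2"
    and "real t \<ge> log (1 / \<rho>)
           (1 + real M * sqrt (real m * real M * G\<^sup>2 + \<sigma>\<^sup>2) / (4 * \<sigma>))"
    and "\<eta> > 0"
    and "\<eta> \<le> Min {1 / (6 * sqrt 2 * L),
                  (1 - \<rho> ^ t) / (sqrt (32 * c * real M) * L),
                  sqrt (1 - \<rho> ^ (2 * t)) /
                    (4 * real m powr (1 / 4) * real M powr (3 / 4) * L)}"
  shows "1 / real N * (\<Sum>k<N. prob_space.expectation P (\<lambda>\<omega>. (norm (g (zbar k \<omega>)))\<^sup>2))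
       \<le> 8 * ((norm (x0 - xstar))\<^sup>2 / (\<eta>\<^sup>2 * real N)
              + 20 * \<sigma>\<^sup>2 / (real m * real M)
              + 48 * (D * L * \<sigma> + \<sigma>\<^sup>2) / sqrt (real m * real M))"
proof -
  note f_int = assms(9) and f_diff = assms(10)
  note L = assms(12) and sigma = assms(13) and D = assms(14)
  have rho: "mixing_rate W < 1" and W: "sym_doubly_stochastic M W"
    using assms(25,26)  by (simp_all add: \<rho>_def)
  have M: "M \<ge> 2" using mixing_rate_less_one_imp_two_le[OF W assms(22) rho] .
  have gs_meas: "(\<lambda>(x, s). gs x s) \<in> borel_measurable (borel \<Otimes>\<^sub>M \<D>)"
    unfolding gs_def using f_int f_diff by (intro borel_measurable_saddle_grad borel_measurable_integrable)
  have eta: "\<eta> > 0" and "\<eta> \<le> (1 - \<rho> ^ t) / (sqrt (32 * c * real M) * L)"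
    using assms(33,34)  by simp_all
  \<comment> \<open>10272 = 32 * 321.\<close>
  then have step: "\<eta> \<le> (1 - \<rho> ^ t) / (sqrt (10272 * real M) * L)" by (simp add: c_def)
  have den: "sqrt (10272 * real M) * L > 0" using M L by simp
  \<comment> \<open>A positive \<open>\<eta>\<close> forces its upper bound to be positive. This
    excludes \<open>t = 0\<close>, which the logarithm fails to do when
    \<open>\<rho> = 0\<close>.\<close>
  have "0 < (1 - \<rho> ^ t) / (sqrt (10272 * real M) * L)" using eta step by linarith
  then have pow: "\<rho> ^ t < 1" using den by (simp add: zero_less_divide_iff)
  have rho0: "0 \<le> \<rho>" by (simp add: \<rho>_def mixing_rate_nonneg)
  have "\<rho> ^ t \<le> 2 / 3" using mixing_power_le[OF rho0 assms(26) pow M sigma assms(32)] .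
  then have "(\<rho> ^ t)\<^sup>2 \<le> (2 / 3)\<^sup>2" using rho0 by (intro power_mono) auto
  also have "(2 / 3)\<^sup>2 = (4 / 9 :: real)" by (simp add: power2_eq_square)
  finally have contraction: "(mixing_rate W ^ t)\<^sup>2 \<le> 4 / 9" unfolding \<rho>_def .
  have small: "10272 * real M * (\<eta> * L)\<^sup>2 \<le> 1"
    by (rule step_size_bound[OF eta L _ step]) (use M rho0 in auto)
  interpret P: prob_space P by (rule assms(27))
  interpret dposg P \<D> gs g L \<sigma> G \<eta> xstar M m N t W \<xi>
  proof (intro dposg.intro dposg_axioms.intro)
    show "prob_space P" "prob_space \<D>" by fact+
  qed (rule gs_meas L assms(15-21) M assms(23) W rho contraction assms(28,29) eta small; assumption?)+
  have "zavg k \<omega> = zbar k \<omega>" for k \<omega>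
    by (simp add: zavg_def zbar_def z_def[abs_def])
  then have "1 / real N * (\<Sum>k<N. P.expectation (\<lambda>\<omega>. (norm (g (zbar k \<omega>)))\<^sup>2))
    \<le> 8 * ((norm (x0 - xstar))\<^sup>2 / (\<eta>\<^sup>2 * real N) + 20 * \<sigma>\<^sup>2 / (real m * real M) + 48 * \<sigma>\<^sup>2 / sqrt (real m * real M))"
    using mean_square_gradient_bound[OF assms(24)] by (simp add: x0_def)
  \<comment> \<open>\<open>D * L * \<sigma>\<close> is positive, so adding it to the numerator
    weakens the bound.\<close>
  also have "\<dots> \<le> 8 * ((norm (x0 - xstar))\<^sup>2 / (\<eta>\<^sup>2 * real N) + 20 * \<sigma>\<^sup>2 / (real m * real M)
      + 48 * (D * L * \<sigma> + \<sigma>\<^sup>2) / sqrt (real m * real M))"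
    using D L sigma by (intro mult_left_mono add_left_mono divide_right_mono) auto
  finally show ?thesis .
qed

end
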